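(* The posets $\overline{\mathcal{FP}}$ and $\overline{\mathcal{SC}}$ are isomorphic.
   Context: $G=(V,E)$ is a finite connected graph, possibly with parallel edges and loops; $\mathbb E$ is the set of oriented edges ($e$ and its reverse $\bar e$). Real $1$-chains $x:\mathbb E\to\mathbb R$ satisfy $x_{\bar e}=-x_e$; $\langle x,y\rangle=\sum_{e\in E}x_ey_e$, $q(x)=\langle x,x\rangle$. A flow satisfies $\sum_{e\text{ with tail }v}x_e=0$ at every vertex $v$; $H$ is the space of real flows and $\Lambda$ the lattice of integer flows. $V_\lambda=\{x\in H: q(x-\lambda)\le q(x-\mu)\ \forall\mu\in\Lambda\}$. $\overline{\mathcal{FP}}$ is the set of nonempty faces of all Voronoi cells $V_\lambda$, $\lambda\in\Lambda$, modulo translation by $\Lambda$ (equivalently, faces $F_1,F_2$ of $V_O$ are identified iff $F_2=F_1+\lambda$ for some $\lambda\in\Lambda$), ordered by $[F_1]\le[F_2]$ iff some representatives satisfy $F_1\subseteq F_2$. $\mathcal{SC}$ is the set of pairs $(H',D)$ with $H'$ a subgraph of $G$ (identified with its edge set) and $D$ a strongly connected orientation of $H'$ (on each component any two vertices joined by directed paths both ways), with $(H_1,D_1)\preceq(H_2,D_2)$ iff $H_2\subseteq H_1$ and $D_2$ is the restriction of $D_1$. On $\mathcal{SC}$, $(H_1,D_1)\sim(H_2,D_2)$ iff $H_1=H_2$ and $D_1,D_2$ have the same out-degree function ($v\mapsto$ number of arcs with tail $v$). $\overline{\mathcal{SC}}=\mathcal{SC}/\sim$ with $[D_1]\preceq[D_2]$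 iff some representatives satisfy $D_1\preceq D_2$. *)

theory Defs
  imports "HOL-Analysis.Analysis"
begin

text \<open>A graph is given by a vertex set V, an edge set E (edges drawn from a finite
  type 'e), and for each edge a reference tail src and head tgt (loops: src e = tgt e;
  parallel edges: distinct edges with equal endpoints).  An oriented edge is a pair
  (e, b): b = True is the reference orientation e, b = False is the reverse.
  A real 1-chain is a vector x in real^'e supported on E, with value x$e on the
  reference orientation and -(x$e) on the reverse orientation.\<close>

definition arcs :: "'e set \<Rightarrow> ('e \<times> bool) set" where
  "arcs E = E \<times> (UNIV :: bool set)"

definition arc_tail :: "('e \<Rightarrow> 'v) \<Rightarrow> ('e \<Rightarrow> 'v) \<Rightarrow> 'e \<times> bool \<Rightarrow> 'v" where
  "arc_tail src tgt a = (if snd a then src (fst a) else tgt (fst a))"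

definition arc_head :: "('e \<Rightarrow> 'v) \<Rightarrow> ('e \<Rightarrow> 'v) \<Rightarrow> 'e \<times> bool \<Rightarrow> 'v" where
  "arc_head src tgt a = (if snd a then tgt (fst a) else src (fst a))"

definition chain_val :: "real ^ 'e \<Rightarrow> 'e \<times> bool \<Rightarrow> real" where
  "chain_val x a = (if snd a then x $ fst a else - (x $ fst a))"

definition is_chain :: "'e set \<Rightarrow> real ^ 'e \<Rightarrow> bool" where
  "is_chain E x \<longleftrightarrow> (\<forall>e. e \<notin> E \<longrightarrow> x $ e = 0)"

text \<open>H: the real flows.\<close>
definition flows :: "'v set \<Rightarrow> 'e set \<Rightarrow> ('e \<Rightarrow> 'v) \<Rightarrow> ('e \<Rightarrow> 'v) \<Rightarrow> (real ^ 'e) set" where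
  "flows V E src tgt = {x. is_chain E x \<and>
     (\<forall>v\<in>V. (\<Sum>a\<in>{a\<in>arcs E. arc_tail src tgt a = v}. chain_val x a) = 0)}"

text \<open>\<Lambda>: the integer flows.\<close>
definition int_flows :: "'v set \<Rightarrow> 'e set \<Rightarrow> ('e \<Rightarrow> 'v) \<Rightarrow> ('e \<Rightarrow> 'v) \<Rightarrow> (real ^ 'e) set" where
  "int_flows V E src tgt = {x \<in> flows V E src tgt. \<forall>e. x $ e \<in> \<int>}"

definition qform :: "'e set \<Rightarrow> real ^ 'e \<Rightarrow> real" where
  "qform E x = (\<Sum>e\<in>E. (x $ e)\<^sup>2)"

definition voronoi :: "'v set \<Rightarrow> 'e set \<Rightarrow> ('e \<Rightarrow> 'v) \<Rightarrow> ('e \<Rightarrow> 'v) \<Rightarrow> real ^ 'e \<Rightarrow> (real ^ 'e) set" where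
  "voronoi V E src tgt l = {x \<in> flows V E src tgt.
     \<forall>m\<in>int_flows V E src tgt. qform E (x - l) \<le> qform E (x - m)}"

text \<open>Nonempty faces of all Voronoi cells, translation by \<Lambda>, and the quotient poset FP-bar.\<close>
definition FP_faces :: "'v set \<Rightarrow> 'e set \<Rightarrow> ('e \<Rightarrow> 'v) \<Rightarrow> ('e \<Rightarrow> 'v) \<Rightarrow> (real ^ 'e) set set" where
  "FP_faces V E src tgt = {F. \<exists>l\<in>int_flows V E src tgt. F face_of voronoi V E src tgt l \<and> F \<noteq> {}}"

definition FP_rel :: "'v set \<Rightarrow> 'e set \<Rightarrow> ('e \<Rightarrow> 'v) \<Rightarrow> ('e \<Rightarrow> 'v) \<Rightarrow> ((real ^ 'e) set \<times> (real ^ 'e) set) set" where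
  "FP_rel V E src tgt = {(F1, F2). F1 \<in> FP_faces V E src tgt \<and> F2 \<in> FP_faces V E src tgt \<and>
     (\<exists>l\<in>int_flows V E src tgt. F2 = (\<lambda>x. x + l) ` F1)}"

definition FPbar :: "'v set \<Rightarrow> 'e set \<Rightarrow> ('e \<Rightarrow> 'v) \<Rightarrow> ('e \<Rightarrow> 'v) \<Rightarrow> (real ^ 'e) set set set" where
  "FPbar V E src tgt = FP_faces V E src tgt // FP_rel V E src tgt"

definition FPbar_le :: "(real ^ 'e) set set \<Rightarrow> (real ^ 'e) set set \<Rightarrow> bool" where
  "FPbar_le C1 C2 \<longleftrightarrow> (\<exists>F1\<in>C1. \<exists>F2\<in>C2. F1 \<subseteq> F2)"

text \<open>Strongly connected orientations.  A pair (H', D): H' a set of edges, D a set of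
  arcs containing exactly one orientation of each edge of H'.\<close>
definition arc_rel :: "('e \<Rightarrow> 'v) \<Rightarrow> ('e \<Rightarrow> 'v) \<Rightarrow> ('e \<times> bool) set \<Rightarrow> ('v \<times> 'v) set" where
  "arc_rel src tgt D = {(arc_tail src tgt a, arc_head src tgt a) | a. a \<in> D}"

text \<open>Strongly connected: any two vertices in the same (undirected) component are
  joined by directed paths (both ways, by symmetry of the hypothesis).\<close>
definition strongly_connected :: "('e \<Rightarrow> 'v) \<Rightarrow> ('e \<Rightarrow> 'v) \<Rightarrow> ('e \<times> bool) set \<Rightarrow> bool" where
  "strongly_connected src tgt D \<longleftrightarrow>
     (\<forall>u w. (u, w) \<in> (arc_rel src tgt D \<union> (arc_rel src tgt D)\<inverse>)\<^sup>* \<longrightarrow> (u, w) \<in> (arc_rel src tgt D)\<^sup>*)"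

definition is_orientation :: "'e set \<Rightarrow> ('e \<times> bool) set \<Rightarrow> bool" where
  "is_orientation H D \<longleftrightarrow> D \<subseteq> arcs H \<and> (\<forall>e\<in>H. \<exists>!b. (e, b) \<in> D)"

definition SC :: "'e set \<Rightarrow> ('e \<Rightarrow> 'v) \<Rightarrow> ('e \<Rightarrow> 'v) \<Rightarrow> ('e set \<times> ('e \<times> bool) set) set" where
  "SC E src tgt = {(H, D). H \<subseteq> E \<and> is_orientation H D \<and> strongly_connected src tgt D}"

definition SC_le :: "'e set \<times> ('e \<times> bool) set \<Rightarrow> 'e set \<times> ('e \<times> bool) set \<Rightarrow> bool" where
  "SC_le p1 p2 \<longleftrightarrow> fst p2 \<subseteq> fst p1 \<and> snd p2 = {a \<in> snd p1. fst a \<in> fst p2}"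

definition outdeg :: "('e \<Rightarrow> 'v) \<Rightarrow> ('e \<Rightarrow> 'v) \<Rightarrow> ('e \<times> bool) set \<Rightarrow> 'v \<Rightarrow> nat" where
  "outdeg src tgt D v = card {a \<in> D. arc_tail src tgt a = v}"

definition SC_rel :: "'e set \<Rightarrow> ('e \<Rightarrow> 'v) \<Rightarrow> ('e \<Rightarrow> 'v) \<Rightarrow>
    (('e set \<times> ('e \<times> bool) set) \<times> ('e set \<times> ('e \<times> bool) set)) set" where
  "SC_rel E src tgt = {(p1, p2). p1 \<in> SC E src tgt \<and> p2 \<in> SC E src tgt \<and> fst p1 = fst p2 \<and>
     outdeg src tgt (snd p1) = outdeg src tgt (snd p2)}"

definition SCbar :: "'e set \<Rightarrow> ('e \<Rightarrow> 'v) \<Rightarrow> ('e \<Rightarrow> 'v) \<Rightarrow> ('e set \<times> ('e \<times> bool) set) set set" where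
  "SCbar E src tgt = SC E src tgt // SC_rel E src tgt"

definition SCbar_le :: "('e set \<times> ('e \<times> bool) set) set \<Rightarrow> ('e set \<times> ('e \<times> bool) set) set \<Rightarrow> bool" where
  "SCbar_le C1 C2 \<longleftrightarrow> (\<exists>p1\<in>C1. \<exists>p2\<in>C2. SC_le p1 p2)"

text \<open>Connectedness of the underlying undirected graph (V, E).\<close>
definition graph_connected :: "'v set \<Rightarrow> 'e set \<Rightarrow> ('e \<Rightarrow> 'v) \<Rightarrow> ('e \<Rightarrow> 'v) \<Rightarrow> bool" where
  "graph_connected V E src tgt \<longleftrightarrow> V \<noteq> {} \<and>
     (\<forall>u\<in>V. \<forall>w\<in>V. (u, w) \<in> ({(src e, tgt e) | e. e \<in> E} \<union> {(tgt e, src e) | e. e \<in> E})\<^sup>*)"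

end

(*
The Voronoi cell V_O is the orthogonal projection of the cube [-1/2, 1/2]^E onto the space H of
real flows.  One inclusion is the bound <y, l> <= |l|_1 / 2 <= q(l) / 2 for integer flows l; the
other follows by separation, since every real flow is a conformal nonnegative combination of
integer flows with entries in {-1, 0, 1}.

Hence the faces of V_O are the projections of the cube faces {y. y_e = s_e / 2 whenever s_e is not 0}
where s is the sign pattern of a flow, and such patterns are exactly the strongly connected
orientations.  The projection of s/2 lies in the face of t only if s extends t, so the inclusion
order on faces is reverse restriction of orientations.  If both s/2 and s/2 + l project into V_O for
an integer flow l, then every nonzero l_e equals -s_e; translating by l therefore reverses s along
the support of l, which is the same as passing to an orientation with the same out-degrees.
*)

theory Submission
  imports Defs
begin

section \<open>Orthogonal projections and quotients\<close>

text \<open>Expansion in an orthonormal basis of \<open>S\<close>. The identity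
  \<open>h \<bullet> f y = h \<bullet> y\<close> for \<open>h\<close> in \<open>S\<close> is the
  form in which the projection is used: functionals from \<open>S\<close> cannot distinguish a point
  from its projection.\<close>

lemma orthogonal_projection_exists:
  fixes S :: "'a::euclidean_space set"
  assumes "subspace S"
  shows "\<exists>f. linear f \<and> range f \<subseteq> S \<and> (\<forall>h\<in>S. \<forall>y. h \<bullet> f y = h \<bullet> y)"
proof -
  obtain B where B: "B \<subseteq> S" "pairwise orthogonal B" "\<And>x. x \<in> B \<Longrightarrow> norm x = 1"
    "independent B" "span B = S"
    using orthonormal_basis_subspace[OF assms] by metis
  have "finite B" using B(4) by (rule independent_imp_finite)
  define f where "f y = (\<Sum>b\<in>B. (b \<bullet> y) *\<^sub>R b)" for y
  have "linear f"
    unfolding f_def by (rule linearI)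
      (simp_all add: inner_add_right scaleR_add_left sum.distrib scaleR_sum_right)
  moreover have "range f \<subseteq> S"
    unfolding f_def B(5)[symmetric] by (auto intro!: span_sum span_scale intro: span_base)
  moreover have "h \<bullet> f y = h \<bullet> y" if "h \<in> S" for h y
  proof -
    have "h \<in> span B" using that B(5) by simp
    then show ?thesis
    proof (induction rule: span_induct_alt)
      case base then show ?case by simp
    next
      case (step c b x)
      have "b \<bullet> f y = (\<Sum>b'\<in>B. if b' = b then b \<bullet> y else 0)"
        unfolding f_def inner_sum_right
      proof (rule sum.cong)
        fix b' assume "b' \<in> B"
        then show "b \<bullet> ((b' \<bullet> y) *\<^sub>R b') = (if b' = b then b \<bullet> y else 0)"
          using B(2,3) step(1) by (auto simp: pairwise_def orthogonal_def dot_square_norm)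
      qed simp
      then have "b \<bullet> f y = b \<bullet> y" using \<open>finite B\<close> step(1) by simp
      then show ?case using step by (simp add: inner_add_left)
    qed
  qed
  ultimately show ?thesis by blast
qed

definition orth_proj :: "'a::euclidean_space set \<Rightarrow> 'a \<Rightarrow> 'a" where
  "orth_proj S = (SOME f. linear f \<and> range f \<subseteq> S \<and> (\<forall>h\<in>S. \<forall>y. h \<bullet> f y = h \<bullet> y))"

lemma
  fixes S :: "'a::euclidean_space set"
  assumes "subspace S"
  shows linear_orth_proj: "linear (orth_proj S)"
    and orth_proj_in: "orth_proj S y \<in> S"
    and inner_orth_proj: "h \<in> S \<Longrightarrow> h \<bullet> orth_proj S y = h \<bullet> y"
proof -
  have "linear (orth_proj S) \<and> range (orth_proj S) \<subseteq> S \<and> (\<forall>h\<in>S. \<forall>y. h \<bullet> orth_proj S y = h \<bullet> y)"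
    unfolding orth_proj_def by (rule someI_ex[OF orthogonal_projection_exists[OF assms]])
  then show "linear (orth_proj S)" "orth_proj S y \<in> S" "h \<in> S \<Longrightarrow> h \<bullet> orth_proj S y = h \<bullet> y"
    by auto
qed

lemma orth_proj_ident:
  fixes S :: "'a::euclidean_space set"
  assumes "subspace S" "x \<in> S"
  shows "orth_proj S x = x"
proof -
  have d: "orth_proj S x - x \<in> S"
    using assms orth_proj_in subspace_diff by blast
  have "(orth_proj S x - x) \<bullet> (orth_proj S x - x) = 0"
    using inner_orth_proj[OF assms(1) d, of x] by (simp add: inner_diff_right)
  then show ?thesis by simp
qed

text \<open>A map that preserves and reflects the relations and meets every class of the target
  induces a bijection of quotients. It is stated by preimages, from \<open>B // S\<close> to
  \<open>A // R\<close>, so that no representatives are chosen; for the poset isomorphism this is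
  the direction from faces to orientations.\<close>

lemma bij_betw_quotient:
  assumes A: "equiv A R" and B: "equiv B S"
    and \<phi>: "\<And>p. p \<in> A \<Longrightarrow> \<phi> p \<in> B"
    and iff: "\<And>p q. p \<in> A \<Longrightarrow> q \<in> A \<Longrightarrow> (\<phi> p, \<phi> q) \<in> S \<longleftrightarrow> (p, q) \<in> R"
    and ex: "\<And>b. b \<in> B \<Longrightarrow> \<exists>p\<in>A. (\<phi> p, b) \<in> S"
  shows "bij_betw (\<lambda>C. {p \<in> A. \<phi> p \<in> C}) (B // S) (A // R)"
proof -
  have RA: "R \<subseteq> A \<times> A" using A by (rule equiv_type)
  have cls: "{p \<in> A. \<phi> p \<in> S `` {\<phi> q}} = R `` {q}" if "q \<in> A" for q
    using iff[OF that] RA by blast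
  have rep: "\<exists>q\<in>A. C = S `` {\<phi> q}" if C: "C \<in> B // S" for C
  proof -
    obtain b where b: "b \<in> B" "C = S `` {b}" using C by (rule quotientE)
    obtain p where p: "p \<in> A" "(\<phi> p, b) \<in> S" using ex[OF b(1)] by blast
    show ?thesis using p(1) equiv_class_eq[OF B p(2)] b(2) by blast
  qed
  have "inj_on (\<lambda>C. {p \<in> A. \<phi> p \<in> C}) (B // S)"
  proof (rule inj_onI)
    fix C C' assume C: "C \<in> B // S" "C' \<in> B // S"
      and eq: "{p \<in> A. \<phi> p \<in> C} = {p \<in> A. \<phi> p \<in> C'}"
    obtain q where q: "q \<in> A" "C = S `` {\<phi> q}" using rep[OF C(1)] by blast
    obtain q' where q': "q' \<in> A" "C' = S `` {\<phi> q'}" using rep[OF C(2)] by blast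
    have "R `` {q} = R `` {q'}" using eq cls[OF q(1)] cls[OF q'(1)] q(2) q'(2) by simp
    then have "(q, q') \<in> R" by (rule eq_equiv_class[OF _ A q'(1)])
    then have "(\<phi> q, \<phi> q') \<in> S" using iff[OF q(1) q'(1)] by simp
    then show "C = C'" using equiv_class_eq[OF B] q(2) q'(2) by simp
  qed
  moreover have "(\<lambda>C. {p \<in> A. \<phi> p \<in> C}) ` (B // S) = A // R"
  proof (intro set_eqI iffI)
    fix X assume "X \<in> (\<lambda>C. {p \<in> A. \<phi> p \<in> C}) ` (B // S)"
    then obtain C where C: "C \<in> B // S" "X = {p \<in> A. \<phi> p \<in> C}" by blast
    obtain q where q: "q \<in> A" "C = S `` {\<phi> q}" using rep[OF C(1)] by blast
    show "X \<in> A // R" using cls[OF q(1)] q C(2) by (simp add: quotientI)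
  next
    fix X assume "X \<in> A // R"
    then obtain q where q: "q \<in> A" "X = R `` {q}" by (rule quotientE)
    show "X \<in> (\<lambda>C. {p \<in> A. \<phi> p \<in> C}) ` (B // S)"
      using cls[OF q(1)] q(2) by (intro image_eqI[where x="S `` {\<phi> q}"] quotientI \<phi>[OF q(1)]) simp
  qed
  ultimately show ?thesis by (simp add: bij_betw_def)
qed

section \<open>Flows and strongly connected orientations\<close>

text \<open>The coboundary of a potential, with sign tail minus head. Summation by parts turns the
  pairing of a chain with it into the sum of net outflows weighted by \<open>p\<close>.\<close>

definition grad :: "('e::finite \<Rightarrow> 'v) \<Rightarrow> ('e \<Rightarrow> 'v) \<Rightarrow> ('v \<Rightarrow> real) \<Rightarrow> real ^ 'e" where
  "grad src tgt p = (\<chi> e. p (src e) - p (tgt e))"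

definition sgn_vec :: "real ^ 'e \<Rightarrow> real ^ 'e::finite" where
  "sgn_vec h = (\<chi> e. sgn (h $ e))"

lemma inner_sgn_vec: "h \<bullet> sgn_vec h = (\<Sum>e\<in>UNIV. \<bar>h $ e\<bar>)"
  by (simp add: inner_vec_def sgn_vec_def mult_sgn_abs linordered_idom_class.abs_sgn)

text \<open>Tail of an edge oriented by the sign of \<open>s\<close>; the head is the tail with respect to \<open>- s\<close>
  (only meaningful where \<open>s\<close> does not vanish).\<close>
definition tail :: "('e::finite \<Rightarrow> 'v) \<Rightarrow> ('e \<Rightarrow> 'v) \<Rightarrow> real ^ 'e \<Rightarrow> 'e \<Rightarrow> 'v" where
  "tail src tgt s e = (if s $ e > 0 then src e else tgt e)"

text \<open>Reversing an edge changes the sign of both factors on the left, so the product sees only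
  the direction selected by \<open>s\<close>. This removes the reference orientation from later sign
  arguments.\<close>

lemma grad_tail:
  "s $ e * grad src tgt p $ e = \<bar>s $ e\<bar> * (p (tail src tgt s e) - p (tail src tgt (- s) e))"
  by (cases "s $ e" "0 :: real" rule: linorder_cases) (auto simp: grad_def tail_def algebra_simps)

text \<open>Repeated images of \<open>W\<close> shrink until they stabilise. Applied to a successor
  map on vertices, this yields directed cycles without handling walks explicitly.\<close>

lemma finite_invariant_subset:
  assumes "finite W" "W \<noteq> {}" "g ` W \<subseteq> W"
  shows "\<exists>P\<subseteq>W. P \<noteq> {} \<and> g ` P = P"
  using assms
proof (induction W rule: finite_psubset_induct)
  case (psubset W)
  show ?case
  proof (cases "g ` W = W")
    case False
    have "g ` W \<subset> W" "g ` W \<noteq> {}" "g ` (g ` W) \<subseteq> g ` W"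
      using False psubset.prems by auto
    from psubset.IH[OF this] obtain P where "P \<subseteq> g ` W" "P \<noteq> {}" "g ` P = P" by auto
    then show ?thesis using psubset.prems(2) by (intro exI[of _ P]) simp
  next
    case True
    then show ?thesis using psubset.prems(1) by (intro exI[of _ W]) simp
  qed
qed

section \<open>Sign vectors and supporting functionals of the cube\<close>

definition sign_vectors :: "'e set \<Rightarrow> (real ^ 'e::finite) set" where
  "sign_vectors E = {s. is_chain E s \<and> (\<forall>e. s $ e \<in> {-1, 0, 1})}"

definition cube :: "(real ^ 'e::finite) set" where
  "cube = {y. \<forall>e. \<bar>y $ e\<bar> \<le> 1 / 2}"

lemma cube_eq_cbox: "(cube :: (real ^ 'e::finite) set) = cbox (\<chi> e. - (1/2)) (\<chi> e. 1/2)"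
proof -
  have "\<bar>a\<bar> \<le> 1/2 \<longleftrightarrow> - (1/2) \<le> a \<and> a \<le> 1/2" for a :: real by linarith
  then show ?thesis by (simp add: cube_def mem_box_cart set_eq_iff)
qed

lemma inner_cube_le:
  assumes "y \<in> cube"
  shows "h \<bullet> y \<le> (\<Sum>e\<in>UNIV. \<bar>h $ e\<bar>) / 2"
proof -
  have "h $ e * y $ e \<le> \<bar>h $ e\<bar> / 2" for e
  proof -
    have "h $ e * y $ e \<le> \<bar>h $ e\<bar> * \<bar>y $ e\<bar>" by (metis abs_ge_self abs_mult)
    also have "\<dots> \<le> \<bar>h $ e\<bar> * (1/2)"
      using assms by (intro mult_left_mono) (auto simp: cube_def)
    finally show ?thesis by simp
  qed
  then show ?thesis
    by (simp add: inner_vec_def sum_divide_distrib sum_mono)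
qed

text \<open>The coordinatewise gaps in \<open>inner_cube_le\<close> are nonnegative, so their sum
  vanishes only if each of them does. The face of the cube exposed by \<open>h\<close> therefore
  depends only on the sign pattern of \<open>h\<close>.\<close>

lemma inner_cube_eq_iff:
  assumes "y \<in> cube"
  shows "h \<bullet> y = (\<Sum>e\<in>UNIV. \<bar>h $ e\<bar>) / 2 \<longleftrightarrow> (\<forall>e. h $ e \<noteq> 0 \<longrightarrow> y $ e = sgn (h $ e) / 2)"
proof -
  have b: "\<bar>y $ e\<bar> \<le> 1/2" for e using assms by (auto simp: cube_def)
  have le: "0 \<le> \<bar>h $ e\<bar> / 2 - h $ e * y $ e" for e
  proof -
    have "h $ e * y $ e \<le> \<bar>h $ e\<bar> * \<bar>y $ e\<bar>" by (metis abs_ge_self abs_mult)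
    also have "\<dots> \<le> \<bar>h $ e\<bar> * (1/2)" using b by (intro mult_left_mono) auto
    finally show ?thesis by simp
  qed
  have "h \<bullet> y = (\<Sum>e\<in>UNIV. \<bar>h $ e\<bar>) / 2 \<longleftrightarrow> (\<Sum>e\<in>UNIV. \<bar>h $ e\<bar> / 2 - h $ e * y $ e) = 0"
    by (auto simp: inner_vec_def sum_divide_distrib sum_subtractf)
  also have "\<dots> \<longleftrightarrow> (\<forall>e. \<bar>h $ e\<bar> / 2 - h $ e * y $ e = 0)"
    using le by (subst sum_nonneg_eq_0_iff) auto
  also have "\<dots> \<longleftrightarrow> (\<forall>e. h $ e \<noteq> 0 \<longrightarrow> y $ e = sgn (h $ e) / 2)"
  proof -
    have "\<bar>a\<bar> / 2 - a * b = a * (sgn a / 2 - b)" for a b :: real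
      by (simp add: algebra_simps mult_sgn_abs linordered_idom_class.abs_sgn)
    then show ?thesis by auto
  qed
  finally show ?thesis .
qed

locale finite_graph =
  fixes V :: "'v set" and E :: "'e::finite set" and src tgt :: "'e \<Rightarrow> 'v"
  assumes finite_V: "finite V"
    and endpoints: "e \<in> E \<Longrightarrow> src e \<in> V \<and> tgt e \<in> V"
begin

abbreviation "H \<equiv> flows V E src tgt"
abbreviation "L \<equiv> int_flows V E src tgt"
abbreviation "gr \<equiv> grad src tgt"

section \<open>Flows as the orthogonal complement of gradients\<close>

lemma inner_grad: 
  assumes "is_chain E x"
  shows "x \<bullet> gr p = (\<Sum>e\<in>E. x $ e * (p (src e) - p (tgt e)))"
  unfolding inner_vec_def grad_def
  by (rule sum.mono_neutral_cong_right) (use assms in \<open>auto simp: is_chain_def\<close>)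

text \<open>Each edge occurs with both orientations, contributing at its two ends with opposite
  signs; the two contributions of a loop cancel.\<close>

lemma divergence_eq:
  assumes "is_chain E x"
  shows "(\<Sum>a\<in>{a\<in>arcs E. arc_tail src tgt a = v}. chain_val x a) = x \<bullet> gr (\<lambda>w. of_bool (w = v))"
proof -
  have "(\<Sum>a\<in>{a\<in>arcs E. arc_tail src tgt a = v}. chain_val x a)
      = (\<Sum>a\<in>E \<times> UNIV. if arc_tail src tgt a = v then chain_val x a else 0)"
    by (simp add: arcs_def sum.inter_filter)
  also have "\<dots> = (\<Sum>e\<in>E. \<Sum>b\<in>UNIV. if arc_tail src tgt (e, b) = v then chain_val x (e, b) else 0)"
    by (subst sum.cartesian_product) auto
  also have "\<dots> = (\<Sum>e\<in>E. x $ e * (of_bool (src e = v) - of_bool (tgt e = v)))"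
    by (intro sum.cong) (auto simp: UNIV_bool arc_tail_def chain_val_def)
  finally show ?thesis using inner_grad[OF assms] by simp
qed

text \<open>On \<open>V\<close>, which contains all endpoints, a potential is a combination of
  vertex indicators, so conservation at each vertex gives orthogonality to every gradient. Cuts are
  the case of an indicator potential.\<close>

lemma flows_iff: "x \<in> H \<longleftrightarrow> is_chain E x \<and> (\<forall>p. x \<bullet> gr p = 0)"
proof (cases "is_chain E x")
  case True
  have decomp: "x \<bullet> gr p = (\<Sum>v\<in>V. p v * (x \<bullet> gr (\<lambda>w. of_bool (w = v))))" for p
  proof -
    have p: "(\<Sum>v\<in>V. p v * of_bool (u = v)) = p u" if "u \<in> V" for u
    proof -
      have "(\<Sum>v\<in>V. p v * of_bool (u = v)) = (\<Sum>v\<in>V. if u = v then p v else 0)"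
        by (rule sum.cong) auto
      then show ?thesis using finite_V that by simp
    qed
    have "(\<Sum>v\<in>V. p v * (x \<bullet> gr (\<lambda>w. of_bool (w = v))))
        = (\<Sum>e\<in>E. \<Sum>v\<in>V. p v * (x $ e * (of_bool (src e = v) - of_bool (tgt e = v))))"
      unfolding inner_grad[OF True] sum_distrib_left by (rule sum.swap)
    also have "\<dots> = (\<Sum>e\<in>E. x $ e * (p (src e) - p (tgt e)))"
    proof (rule sum.cong[OF refl])
      fix e assume "e \<in> E"
      have "(\<Sum>v\<in>V. p v * (x $ e * (of_bool (src e = v) - of_bool (tgt e = v))))
          = (\<Sum>v\<in>V. x $ e * (p v * of_bool (src e = v)) - x $ e * (p v * of_bool (tgt e = v)))"
        by (rule sum.cong[OF refl]) (simp only: right_diff_distrib mult.left_commute)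
      also have "\<dots> = x $ e * (p (src e) - p (tgt e))"
        unfolding sum_subtractf sum_distrib_left[symmetric]
        using endpoints[OF \<open>e \<in> E\<close>] by (simp only: p right_diff_distrib)
      finally show "(\<Sum>v\<in>V. p v * (x $ e * (of_bool (src e = v) - of_bool (tgt e = v))))
          = x $ e * (p (src e) - p (tgt e))" .
    qed
    also have "\<dots> = x \<bullet> gr p" unfolding inner_grad[OF True] ..
    finally show ?thesis ..
  qed
  have "x \<bullet> gr p = 0" if "\<forall>v\<in>V. x \<bullet> gr (\<lambda>w. of_bool (w = v)) = 0" for p
    unfolding decomp[of p] using that by (intro sum.neutral) simp
  then show ?thesis
    using True divergence_eq[OF True] by (simp add: flows_def) blast
qed (simp add: flows_def)

lemma subspace_flows: "subspace H"
  unfolding subspace_def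
  by (auto simp: flows_iff is_chain_def inner_add_left)

lemma int_flows_iff: "l \<in> L \<longleftrightarrow> l \<in> H \<and> (\<forall>e. l $ e \<in> \<int>)"
  by (simp add: int_flows_def)

lemma zero_int_flows: "0 \<in> L"
  using subspace_0[OF subspace_flows] by (simp add: int_flows_iff)

lemma add_int_flows: "l \<in> L \<Longrightarrow> m \<in> L \<Longrightarrow> l + m \<in> L"
  using subspace_add[OF subspace_flows] by (simp add: int_flows_iff)

lemma diff_int_flows: "l \<in> L \<Longrightarrow> m \<in> L \<Longrightarrow> l - m \<in> L"
  using subspace_diff[OF subspace_flows] by (simp add: int_flows_iff)

lemma qform_eq: 
  assumes "x \<in> H"
  shows "qform E x = x \<bullet> x"
proof -
  have "is_chain E x" using assms by (simp add: flows_iff)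
  then show ?thesis
    unfolding qform_def inner_vec_def power2_eq_square
    by (intro sum.mono_neutral_cong_left) (auto simp: is_chain_def)
qed

text \<open>A sign vector is strongly connected iff no cut of its support is directed. This form
  depends only on the sum over each cut, which adding a flow does not change.\<close>
definition cut_strong :: "real ^ 'e \<Rightarrow> bool" where
  "cut_strong s \<longleftrightarrow> (\<forall>S. (\<forall>e. s $ e * gr (\<lambda>v. of_bool (v \<in> S)) $ e \<le> 0)
      \<longrightarrow> (\<forall>e. s $ e * gr (\<lambda>v. of_bool (v \<in> S)) $ e = 0))"

text \<open>These vectors encode the elements of \<open>SC\<close>: an entry 1 or -1 gives the
  direction of an edge of the subgraph, and 0 marks an edge outside it. \<open>orient_vec\<close>
  provides the translation.\<close>

definition SV :: "(real ^ 'e) set" where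
  "SV = {s \<in> sign_vectors E. cut_strong s}"

text \<open>The sum across a cut is unchanged by adding the flow \<open>2 l\<close>. Nonpositive
  terms with the old absolute values are at most the old terms, so equal sums force the two families
  to agree term by term.\<close>

lemma cut_strong_shift:
  assumes s: "cut_strong s" and l: "l \<in> H" and abs: "\<And>e. \<bar>(s + 2 *\<^sub>R l) $ e\<bar> = \<bar>s $ e\<bar>"
  shows "cut_strong (s + 2 *\<^sub>R l)"
  unfolding cut_strong_def
proof (rule allI, rule impI)
  fix S
  define d where "d = gr (\<lambda>v. of_bool (v \<in> S))"
  assume "\<forall>e. (s + 2 *\<^sub>R l) $ e * gr (\<lambda>v. of_bool (v \<in> S)) $ e \<le> 0"
  then have le: "(s + 2 *\<^sub>R l) $ e * d $ e \<le> 0" for e by (simp add: d_def)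
  have eqabs: "\<bar>(s + 2 *\<^sub>R l) $ e * d $ e\<bar> = \<bar>s $ e * d $ e\<bar>" for e
    using abs by (simp add: abs_mult)
  have ge: "0 \<le> s $ e * d $ e - (s + 2 *\<^sub>R l) $ e * d $ e" for e
    using le[of e] eqabs[of e] by linarith
  have "(s + 2 *\<^sub>R l) \<bullet> d = s \<bullet> d"
    using l by (simp add: flows_iff inner_add_left d_def)
  then have "(\<Sum>e\<in>UNIV. s $ e * d $ e - (s + 2 *\<^sub>R l) $ e * d $ e) = 0"
    by (simp add: inner_vec_def sum_subtractf)
  then have "\<forall>e. s $ e * d $ e - (s + 2 *\<^sub>R l) $ e * d $ e = 0"
    using ge by (subst (asm) sum_nonneg_eq_0_iff) auto
  then have eq: "(s + 2 *\<^sub>R l) $ e * d $ e = s $ e * d $ e" for e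
    by (metis eq_iff_diff_eq_0)
  have "\<forall>e. s $ e * d $ e \<le> 0" using le eq by metis
  then have "\<forall>e. s $ e * d $ e = 0" using s unfolding cut_strong_def d_def by blast
  then show "\<forall>e. (s + 2 *\<^sub>R l) $ e * gr (\<lambda>v. of_bool (v \<in> S)) $ e = 0"
    using eq by (metis d_def)
qed

section \<open>Sign patterns of flows\<close>

lemma sgn_vec_flow_in_SV:
  assumes h: "h \<in> H"
  shows "sgn_vec h \<in> SV"
proof -
  have "sgn_vec h \<in> sign_vectors E"
    using h by (auto simp: sign_vectors_def sgn_vec_def flows_iff is_chain_def sgn_if)
  moreover have "cut_strong (sgn_vec h)"
    unfolding cut_strong_def
  proof (rule allI, rule impI)
    fix S
    define d where "d = gr (\<lambda>v. of_bool (v \<in> S))"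
    assume "\<forall>e. sgn_vec h $ e * gr (\<lambda>v. of_bool (v \<in> S)) $ e \<le> 0"
    then have "sgn (h $ e * d $ e) \<le> 0" for e
      by (auto simp: sgn_vec_def d_def sgn_mult mult_le_0_iff)
    then have le: "h $ e * d $ e \<le> 0" for e by simp
    \<comment> \<open>The net flow across a cut is zero, so contributions of one sign must all
      vanish.\<close>
    have "h \<bullet> d = 0" using h by (simp add: flows_iff d_def)
    then have "(\<Sum>e\<in>UNIV. - (h $ e * d $ e)) = 0" by (simp add: inner_vec_def sum_negf)
    then have "\<forall>e. h $ e * d $ e = 0"
      using le by (subst (asm) sum_nonneg_eq_0_iff) auto
    then show "\<forall>e. sgn_vec h $ e * gr (\<lambda>v. of_bool (v \<in> S)) $ e = 0"
      by (auto simp: sgn_vec_def d_def sgn_eq_0_iff)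
  qed
  ultimately show ?thesis by (simp add: SV_def)
qed

text \<open>Conservation at the head of \<open>e\<close>: if no support edge left this vertex,
  testing \<open>h\<close> against its indicator would give only nonpositive terms with sum 0, yet
  the term of \<open>e\<close> is strictly negative.\<close>

lemma flow_tail_continues:
  assumes h: "h \<in> H" and e: "h $ e \<noteq> 0"
  shows "\<exists>e'. h $ e' \<noteq> 0 \<and> tail src tgt h e' = tail src tgt (- h) e"
proof (rule ccontr)
  assume no: "\<not> ?thesis"
  define p :: "'v \<Rightarrow> real" where "p = (\<lambda>w. of_bool (w = tail src tgt (- h) e))"
  have p0: "h $ e' \<noteq> 0 \<Longrightarrow> p (tail src tgt h e') = 0" for e'
    using no by (auto simp: p_def)
  have ge: "0 \<le> - (h $ e' * gr p $ e')" for e'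
    unfolding grad_tail using p0[of e'] by (cases "h $ e' = 0") (auto simp: p_def)
  have "h \<bullet> gr p = 0" using h by (simp add: flows_iff)
  then have "(\<Sum>e'\<in>UNIV. - (h $ e' * gr p $ e')) = 0" by (simp add: inner_vec_def sum_negf)
  then have "- (h $ e * gr p $ e) = 0"
    using ge by (subst (asm) sum_nonneg_eq_0_iff) auto
  then show False unfolding grad_tail using p0[OF e] e by (simp add: p_def)
qed

text \<open>One outgoing support edge is chosen at every tail. Following the chosen edges permutes
  some nonempty set \<open>P\<close> of vertices, so the edges chosen on \<open>P\<close> form
  disjoint directed cycles, and a unit flow around them is \<open>l\<close>.\<close>

lemma exists_circulation:
  assumes h: "h \<in> H" "h \<noteq> 0"
  shows "\<exists>l\<in>L. l \<noteq> 0 \<and> (\<forall>e. l $ e \<noteq> 0 \<longrightarrow> l $ e = sgn (h $ e))"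
proof -
  define tl where "tl = tail src tgt h"
  define hd where "hd = tail src tgt (- h)"
  define W where "W = tl ` {e. h $ e \<noteq> 0}"
  define ed where "ed v = (SOME e. h $ e \<noteq> 0 \<and> tl e = v)" for v
  have ed: "h $ ed v \<noteq> 0 \<and> tl (ed v) = v" if "v \<in> W" for v
    unfolding ed_def by (rule someI_ex) (use that in \<open>auto simp: W_def\<close>)
  have "(\<lambda>v. hd (ed v)) ` W \<subseteq> W"
  proof
    fix w assume "w \<in> (\<lambda>v. hd (ed v)) ` W"
    then obtain v where v: "v \<in> W" "w = hd (ed v)" by blast
    obtain e' where "h $ e' \<noteq> 0" "tl e' = hd (ed v)"
      using flow_tail_continues[OF h(1)] ed[OF v(1)] unfolding tl_def hd_def by blast
    then show "w \<in> W" using v by (auto simp: W_def intro!: image_eqI[where x=e'])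
  qed
  moreover have "W \<noteq> {}" using h(2) by (auto simp: W_def vec_eq_iff)
  moreover have "finite W" by (simp add: W_def)
  ultimately obtain P where P: "P \<subseteq> W" "P \<noteq> {}" "(\<lambda>v. hd (ed v)) ` P = P"
    using finite_invariant_subset by metis
  have "finite P" using P(1) \<open>finite W\<close> finite_subset by blast
  then have inj: "inj_on (\<lambda>v. hd (ed v)) P" using P(3) by (simp add: eq_card_imp_inj_on)
  have inj_ed: "inj_on ed P" using ed P(1) by (metis inj_onI subsetD)
  define l :: "real ^ 'e" where "l = (\<chi> e. if e \<in> ed ` P then sgn (h $ e) else 0)"
  have "l \<bullet> gr p = 0" for p
  proof -
    have "l \<bullet> gr p = (\<Sum>e\<in>ed ` P. p (tl e) - p (hd e))"
    proof -
      have "sgn (h $ e) * gr p $ e = p (tl e) - p (hd e)" if "e \<in> ed ` P" for e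
        using that ed P(1) by (auto simp: grad_def tl_def hd_def tail_def sgn_if)
      then show ?thesis
        unfolding inner_vec_def by (intro sum.mono_neutral_cong_right) (auto simp: l_def)
    qed
    also have "\<dots> = (\<Sum>v\<in>P. p v) - (\<Sum>v\<in>P. p (hd (ed v)))"
      using ed P(1) by (auto simp: sum.reindex[OF inj_ed] sum_subtractf[symmetric] intro!: sum.cong)
    also have "(\<Sum>v\<in>P. p (hd (ed v))) = (\<Sum>v\<in>P. p v)"
      using sum.reindex[OF inj, of p] P(3) by simp
    finally show ?thesis by simp
  qed
  moreover have "is_chain E l"
    using h(1) by (auto simp: is_chain_def l_def flows_iff)
  ultimately have "l \<in> L" by (auto simp: int_flows_iff flows_iff l_def sgn_if)
  moreover have "l \<noteq> 0"
  proof -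
    obtain v where "v \<in> P" using P(2) by blast
    then have "l $ ed v \<noteq> 0" using ed P(1) by (auto simp: l_def sgn_eq_0_iff)
    then show ?thesis by auto
  qed
  moreover have "\<forall>e. l $ e \<noteq> 0 \<longrightarrow> l $ e = sgn (h $ e)" by (simp add: l_def)
  ultimately show ?thesis by blast
qed

text \<open>One unit is sent along the path. An edge traversed repeatedly is always used in the
  direction given by \<open>s\<close>, so the chain stays conformal to \<open>s\<close>; its
  boundary is the pair of end vertices.\<close>

lemma path_flow:
  assumes s: "s \<in> sign_vectors E"
    and path: "(u, w) \<in> {(tail src tgt s e, tail src tgt (- s) e) | e. s $ e \<noteq> 0}\<^sup>*"
  shows "\<exists>x. is_chain E x \<and> (\<forall>e. 0 \<le> s $ e * x $ e \<and> (s $ e = 0 \<longrightarrow> x $ e = 0)) \<and>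
    (\<forall>p. x \<bullet> gr p = p u - p w)"
  using path
proof (induction rule: rtrancl_induct)
  case base
  show ?case by (rule exI[of _ 0]) (simp add: is_chain_def)
next
  case (step w z)
  obtain x where x: "is_chain E x" "\<And>e. 0 \<le> s $ e * x $ e" "\<And>e. s $ e = 0 \<Longrightarrow> x $ e = 0"
    "\<And>p. x \<bullet> gr p = p u - p w" using step.IH by blast
  obtain e where e: "s $ e \<noteq> 0" "w = tail src tgt s e" "z = tail src tgt (- s) e"
    using step.hyps by blast
  have se: "s $ e \<in> {-1, 1}" "e \<in> E" using s e(1) by (auto simp: sign_vectors_def is_chain_def)
  define x' where "x' = x + axis e (s $ e)"
  have "is_chain E x'" using x(1) se by (auto simp: x'_def is_chain_def axis_def)
  moreover have "\<forall>f. 0 \<le> s $ f * x' $ f \<and> (s $ f = 0 \<longrightarrow> x' $ f = 0)"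
    using x(2,3) by (auto simp: x'_def axis_def distrib_left)
  moreover have "x' \<bullet> gr p = p u - p z" for p
  proof -
    have "axis e (s $ e) \<bullet> gr p = s $ e * gr p $ e" by (simp add: inner_axis')
    also have "\<dots> = p w - p z" unfolding grad_tail e(2,3) using se by auto
    finally show ?thesis by (simp add: x'_def inner_add_left x(4))
  qed
  ultimately show ?case by blast
qed

text \<open>Converse of \<open>sgn_vec_flow_in_SV\<close>. Every support edge lies on a directed
  closed walk, which carries a flow conformal to \<open>s\<close> and nonzero on that edge.
  Conformal flows do not cancel, so their sum has the full pattern \<open>s\<close>.\<close>

lemma SV_eq_sgn_vec_flow:
  assumes "s \<in> SV"
  shows "\<exists>h\<in>H. sgn_vec h = s"
proof -
  have s: "s \<in> sign_vectors E" and cut: "cut_strong s" using assms by (auto simp: SV_def)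
  let ?R = "{(tail src tgt s e, tail src tgt (- s) e) | e. s $ e \<noteq> 0}"
  have ex: "\<exists>x. x \<in> H \<and> (\<forall>f. 0 \<le> s $ f * x $ f \<and> (s $ f = 0 \<longrightarrow> x $ f = 0)) \<and> (s $ e \<noteq> 0 \<longrightarrow> 0 < s $ e * x $ e)" for e
  proof (cases "s $ e = 0")
    case True
    then show ?thesis using subspace_0[OF subspace_flows] by (intro exI[of _ 0]) simp
  next
    case False
    have se: "s $ e \<in> {-1, 1}" "e \<in> E" using s False by (auto simp: sign_vectors_def is_chain_def)
    \<comment> \<open>The vertices reachable from the head of \<open>e\<close>. No support edge
      leaves \<open>S\<close>, so by \<open>cut_strong\<close> none enters it either; hence the tail
      of \<open>e\<close> is reachable from its head.\<close>
    define S where "S = ?R\<^sup>* `` {tail src tgt (- s) e}"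
    have closed: "s $ f \<noteq> 0 \<Longrightarrow> tail src tgt s f \<in> S \<Longrightarrow> tail src tgt (- s) f \<in> S" for f
      unfolding S_def by (blast intro: rtrancl_into_rtrancl)
    have "s $ f * gr (\<lambda>v. of_bool (v \<in> S)) $ f \<le> 0" for f
      unfolding grad_tail using closed[of f] by (cases "s $ f = 0") (auto simp: mult_le_0_iff)
    then have "s $ e * gr (\<lambda>v. of_bool (v \<in> S)) $ e = 0" using cut by (simp add: cut_strong_def)
    then have "tail src tgt s e \<in> S" unfolding grad_tail using False by (auto simp: S_def split: if_splits)
    then have "(tail src tgt (- s) e, tail src tgt s e) \<in> ?R\<^sup>*" by (simp add: S_def)
    from path_flow[OF s this] obtain x where x: "is_chain E x" "\<And>f. 0 \<le> s $ f * x $ f"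
      "\<And>f. s $ f = 0 \<Longrightarrow> x $ f = 0" "\<And>p. x \<bullet> gr p = p (tail src tgt (- s) e) - p (tail src tgt s e)" by blast
    \<comment> \<open>Adding \<open>e\<close> itself closes the path from its head back to its
      tail.\<close>
    define x' where "x' = x + axis e (s $ e)"
    have "is_chain E x'" using x(1) se by (auto simp: x'_def is_chain_def axis_def)
    moreover have "x' \<bullet> gr p = 0" for p
    proof -
      have "axis e (s $ e) \<bullet> gr p = s $ e * gr p $ e" by (simp add: inner_axis')
      also have "\<dots> = p (tail src tgt s e) - p (tail src tgt (- s) e)" unfolding grad_tail using se by auto
      finally show ?thesis by (simp add: x'_def inner_add_left x(4))
    qed
    ultimately have "x' \<in> H" by (simp add: flows_iff)
    moreover have "\<forall>f. 0 \<le> s $ f * x' $ f \<and> (s $ f = 0 \<longrightarrow> x' $ f = 0)"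
      using x(2,3) by (auto simp: x'_def axis_def distrib_left)
    moreover have "0 < s $ e * x' $ e"
    proof -
      have "s $ e * s $ e = 1" using se by auto
      then show ?thesis using x(2)[of e] by (simp add: x'_def axis_def distrib_left)
    qed
    ultimately show ?thesis by blast
  qed
  obtain x where x: "\<And>e. x e \<in> H" "\<And>e f. 0 \<le> s $ f * x e $ f" "\<And>e f. s $ f = 0 \<Longrightarrow> x e $ f = 0"
    "\<And>e. s $ e \<noteq> 0 \<Longrightarrow> 0 < s $ e * x e $ e"
    using ex by metis
  define h where "h = (\<Sum>e\<in>UNIV. x e)"
  have "h \<in> H" unfolding h_def by (rule subspace_sum[OF subspace_flows]) (rule x(1))
  moreover have "sgn (h $ f) = s $ f" for f
  proof (cases "s $ f = 0")
    case True
    then show ?thesis by (simp add: h_def x(3))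
  next
    case False
    have "s $ f * h $ f = (\<Sum>e\<in>UNIV. s $ f * x e $ f)" by (simp add: h_def sum_distrib_left)
    also have "\<dots> > 0" by (rule sum_pos2[of _ f]) (use x(2,4) False in auto)
    finally have "s $ f * h $ f > 0" .
    moreover have "s $ f \<in> {-1, 1}" using s False by (auto simp: sign_vectors_def)
    ultimately show ?thesis by (auto simp: sgn_if)
  qed
  ultimately show ?thesis by (intro bexI[of _ h]) (auto simp: sgn_vec_def vec_eq_iff)
qed

subsection \<open>The Voronoi cell as a projected cube\<close>

abbreviation "pr \<equiv> orth_proj H"

lemmas linear_pr = linear_orth_proj[OF subspace_flows]
lemmas pr_in = orth_proj_in[OF subspace_flows]
lemmas inner_pr = inner_orth_proj[OF subspace_flows]
lemmas pr_ident = orth_proj_ident[OF subspace_flows]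

lemma int_flow_abs_le: "l \<in> L \<Longrightarrow> \<bar>l $ e\<bar> \<le> l $ e * l $ e"
proof -
  assume "l \<in> L"
  then obtain i where i: "l $ e = of_int i" by (auto simp: int_flows_iff elim: Ints_cases)
  have "\<bar>i\<bar> * 1 \<le> \<bar>i\<bar> * \<bar>i\<bar>" by (cases "i = 0") (simp, intro mult_left_mono, simp_all)
  then have "\<bar>i\<bar> \<le> i * i" by simp
  then show ?thesis unfolding i by (metis of_int_abs of_int_le_iff of_int_mult)
qed

text \<open>Expanding the squares cancels \<open>x \<bullet> x\<close> and leaves one half-space for
  each lattice vector.\<close>

lemma voronoi_0_iff: "x \<in> voronoi V E src tgt 0 \<longleftrightarrow> x \<in> H \<and> (\<forall>m\<in>L. 2 * (m \<bullet> x) \<le> m \<bullet> m)"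
proof -
  have "qform E (x - 0) \<le> qform E (x - m) \<longleftrightarrow> 2 * (m \<bullet> x) \<le> m \<bullet> m" if "x \<in> H" "m \<in> L" for m
  proof -
    have "m \<in> H" using that by (simp add: int_flows_iff)
    then have "x - m \<in> H" using that subspace_diff[OF subspace_flows] by simp
    then show ?thesis using that
      by (simp add: qform_eq inner_diff_left inner_diff_right inner_commute)
  qed
  then show ?thesis by (auto simp: voronoi_def)
qed

lemma voronoi_translate_iff:
  assumes l: "l \<in> L"
  shows "x \<in> voronoi V E src tgt l \<longleftrightarrow> x - l \<in> voronoi V E src tgt 0"
proof -
  have lH: "l \<in> H" using l by (simp add: int_flows_iff)
  have H: "x \<in> H \<longleftrightarrow> x - l \<in> H"
    using subspace_diff[OF subspace_flows _ lH, of x] subspace_add[OF subspace_flows _ lH, of "x - l"] by auto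
  have "(\<forall>m\<in>L. qform E (x - l) \<le> qform E (x - m)) \<longleftrightarrow> (\<forall>m\<in>L. qform E (x - l - 0) \<le> qform E (x - l - m))"
  proof (intro iffI ballI)
    fix m assume a: "\<forall>m\<in>L. qform E (x - l) \<le> qform E (x - m)" "m \<in> L"
    show "qform E (x - l - 0) \<le> qform E (x - l - m)"
      using a(1) add_int_flows[OF l a(2)] by (simp add: diff_diff_eq)
  next
    fix m assume a: "\<forall>m\<in>L. qform E (x - l - 0) \<le> qform E (x - l - m)" "m \<in> L"
    show "qform E (x - l) \<le> qform E (x - m)"
      using bspec[OF a(1) diff_int_flows[OF a(2) l]] by simp
  qed
  then show ?thesis unfolding voronoi_def using H by simp
qed

lemma voronoi_translate:
  assumes l: "l \<in> L"
  shows "voronoi V E src tgt l = (+) l ` voronoi V E src tgt 0"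
proof (intro set_eqI iffI)
  fix x assume "x \<in> voronoi V E src tgt l"
  then show "x \<in> (+) l ` voronoi V E src tgt 0"
    using voronoi_translate_iff[OF l, of x] by (intro image_eqI[where x="x - l"]) auto
next
  fix x assume "x \<in> (+) l ` voronoi V E src tgt 0"
  then show "x \<in> voronoi V E src tgt l"
    using voronoi_translate_iff[OF l, of x] by auto
qed

text \<open>Peeling off circulations conformal to the flow reduces the \<open>\<ell>\<^sup>1\<close> bound to
  integer flows with entries in \<open>{-1, 0, 1}\<close>, for which \<open>\<ell>\<^sup>1\<close> and squared \<open>\<ell>\<^sup>2\<close> norms agree.\<close>
lemma inner_voronoi_le:
  assumes x: "x \<in> voronoi V E src tgt 0" and "h \<in> H"
  shows "h \<bullet> x \<le> (\<Sum>e\<in>UNIV. \<bar>h $ e\<bar>) / 2"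
  using assms(2)
proof (induction "card {e. h $ e \<noteq> 0}" arbitrary: h rule: less_induct)
  case less
  show ?case
  proof (cases "h = 0")
    case False
    obtain l where l: "l \<in> L" "l \<noteq> 0" "\<And>e. l $ e \<noteq> 0 \<Longrightarrow> l $ e = sgn (h $ e)"
      using exists_circulation[OF less.prems False] by blast
    define T where "T = {e. l $ e \<noteq> 0}"
    \<comment> \<open>The largest multiple of \<open>l\<close> that can be subtracted without
      reversing a sign of \<open>h\<close>. It makes the coordinate \<open>e0\<close> vanish, so the
      support shrinks, and by conformality the absolute values subtract exactly.\<close>
    define t where "t = Min ((\<lambda>e. \<bar>h $ e\<bar>) ` T)"
    have T: "finite T" "T \<noteq> {}" using l(2) by (auto simp: T_def vec_eq_iff)
    have "t \<in> (\<lambda>e. \<bar>h $ e\<bar>) ` T" unfolding t_def using T by (intro Min_in) auto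
    then obtain e0 where e0: "e0 \<in> T" "t = \<bar>h $ e0\<bar>" by auto
    have tle: "t \<le> \<bar>h $ e\<bar>" if "e \<in> T" for e unfolding t_def using T that by (intro Min_le) auto
    define h' where "h' = h - t *\<^sub>R l"
    have lH: "l \<in> H" using l(1) by (simp add: int_flows_iff)
    have h'H: "h' \<in> H" unfolding h'_def
      using less.prems lH subspace_flows by (intro subspace_diff subspace_scale) auto
    have abs_h': "\<bar>h' $ e\<bar> = \<bar>h $ e\<bar> - t * \<bar>l $ e\<bar>" for e
    proof (cases "e \<in> T")
      case True
      then show ?thesis using l(3)[of e] tle[of e] by (auto simp: T_def h'_def sgn_if abs_if split: if_splits)
    qed (simp add: T_def h'_def)
    have supp: "e \<in> T \<Longrightarrow> h $ e \<noteq> 0" for e using l(3)[of e] by (auto simp: T_def)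
    have "{e. h' $ e \<noteq> 0} \<subset> {e. h $ e \<noteq> 0}"
    proof
      show "{e. h' $ e \<noteq> 0} \<subseteq> {e. h $ e \<noteq> 0}" using supp by (auto simp: h'_def T_def)
      have "\<bar>l $ e0\<bar> = 1" using l(3)[of e0] supp[OF e0(1)] e0(1) by (auto simp: T_def sgn_if)
      then have "h' $ e0 = 0" using abs_h'[of e0] e0(2) by simp
      then show "{e. h' $ e \<noteq> 0} \<noteq> {e. h $ e \<noteq> 0}" using supp[OF e0(1)] by blast
    qed
    then have "card {e. h' $ e \<noteq> 0} < card {e. h $ e \<noteq> 0}" by (intro psubset_card_mono) auto
    then have IH: "h' \<bullet> x \<le> (\<Sum>e\<in>UNIV. \<bar>h' $ e\<bar>) / 2" using less.hyps h'H by blast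
    have "l \<bullet> l = (\<Sum>e\<in>UNIV. \<bar>l $ e\<bar>)"
    proof -
      have "l $ e * l $ e = \<bar>l $ e\<bar>" for e using l(3)[of e] by (cases "l $ e = 0") (auto simp: sgn_if)
      then show ?thesis by (simp add: inner_vec_def)
    qed
    then have "l \<bullet> x \<le> (\<Sum>e\<in>UNIV. \<bar>l $ e\<bar>) / 2" using x l(1) by (auto simp: voronoi_0_iff)
    then have "t * (l \<bullet> x) \<le> t * ((\<Sum>e\<in>UNIV. \<bar>l $ e\<bar>) / 2)"
      using e0(2) by (intro mult_left_mono) auto
    moreover have "h \<bullet> x = h' \<bullet> x + t * (l \<bullet> x)" by (simp add: h'_def inner_diff_left)
    moreover have "(\<Sum>e\<in>UNIV. \<bar>h' $ e\<bar>) = (\<Sum>e\<in>UNIV. \<bar>h $ e\<bar>) - t * (\<Sum>e\<in>UNIV. \<bar>l $ e\<bar>)"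
      by (simp add: abs_h' sum_subtractf sum_distrib_left)
    ultimately show ?thesis using IH by simp
  qed simp
qed

text \<open>Supplies closedness for the separation argument and, later, that every face is
  exposed.\<close>

lemma polytope_pr_cube: "polytope (pr ` cube)"
  unfolding cube_eq_cbox by (intro polytope_linear_image linear_pr polytope_interval)

lemma half_sgn_vec_in_cube: "(1/2) *\<^sub>R sgn_vec h \<in> cube"
  by (auto simp: cube_def sgn_vec_def sgn_if)

lemma voronoi_eq_pr_cube: "voronoi V E src tgt 0 = pr ` cube"
proof (intro set_eqI iffI)
  fix x assume x: "x \<in> voronoi V E src tgt 0"
  then have xH: "x \<in> H" by (simp add: voronoi_0_iff)
  show "x \<in> pr ` cube"
  proof (rule ccontr)
    assume "x \<notin> pr ` cube"
    then obtain a b where ab: "a \<bullet> x < b" "\<And>z. z \<in> pr ` cube \<Longrightarrow> b < a \<bullet> z"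
      using separating_hyperplane_closed_point[of "pr ` cube" x] polytope_pr_cube
        polytope_imp_convex polytope_imp_closed by blast
    \<comment> \<open>Both \<open>x\<close> and the projected cube lie in \<open>H\<close>, so the
      normal may be replaced by its projection, a flow to which \<open>inner_voronoi_le\<close>
      applies. The sign is reversed because \<open>x\<close> is on the lower side of the
      hyperplane.\<close>
    define h where "h = pr (- a)"
    have hH: "h \<in> H" unfolding h_def by (rule pr_in)
    have h_inner: "h \<bullet> z = - (a \<bullet> z)" if "z \<in> H" for z
      using inner_pr[OF that, of "- a"] by (simp add: h_def inner_commute)
    \<comment> \<open>A point of the cube where \<open>h\<close> attains its maximum; its projection
      contradicts the separation.\<close>
    define y where "y = (1/2) *\<^sub>R sgn_vec h"
    have "h \<bullet> x \<le> (\<Sum>e\<in>UNIV. \<bar>h $ e\<bar>) / 2" by (rule inner_voronoi_le[OF x hH])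
    also have "\<dots> = h \<bullet> y" by (simp add: y_def inner_sgn_vec)
    also have "\<dots> = h \<bullet> pr y" by (rule inner_pr[OF hH, symmetric])
    also have "\<dots> = - (a \<bullet> pr y)" by (rule h_inner[OF pr_in])
    also have "\<dots> < - b" using ab(2)[OF imageI[OF half_sgn_vec_in_cube]] by (simp add: y_def)
    finally show False using h_inner[OF xH] ab(1) by simp
  qed
next
  fix x assume "x \<in> pr ` cube"
  then obtain y where y: "y \<in> cube" "x = pr y" by blast
  have "2 * (m \<bullet> x) \<le> m \<bullet> m" if m: "m \<in> L" for m
  proof -
    have "m \<bullet> x = m \<bullet> y" using m inner_pr by (simp add: int_flows_iff y(2))
    also have "\<dots> \<le> (\<Sum>e\<in>UNIV. \<bar>m $ e\<bar>) / 2" by (rule inner_cube_le[OF y(1)])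
    also have "\<dots> \<le> (m \<bullet> m) / 2"
      using int_flow_abs_le[OF m] by (simp add: inner_vec_def sum_mono)
    finally show ?thesis by simp
  qed
  then show "x \<in> voronoi V E src tgt 0" using pr_in by (simp add: voronoi_0_iff y(2))
qed

subsection \<open>Faces of the Voronoi cell\<close>

definition sign_face :: "real ^ 'e \<Rightarrow> (real ^ 'e) set" where
  "sign_face s = pr ` {y \<in> cube. \<forall>e. s $ e \<noteq> 0 \<longrightarrow> y $ e = s $ e / 2}"

text \<open>A flow takes the same value at \<open>y\<close> and at \<open>pr y\<close>, so
  maximising it over the projected cube amounts to maximising it over the cube, where
  \<open>inner_cube_eq_iff\<close> describes the maximisers.\<close>

lemma sign_face_eq_hyperplane:
  assumes h: "h \<in> H"
  shows "pr ` cube \<inter> {x. h \<bullet> x = (\<Sum>e\<in>UNIV. \<bar>h $ e\<bar>) / 2} = sign_face (sgn_vec h)"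
proof -
  have "h \<bullet> pr y = (\<Sum>e\<in>UNIV. \<bar>h $ e\<bar>) / 2 \<longleftrightarrow> (\<forall>e. sgn_vec h $ e \<noteq> 0 \<longrightarrow> y $ e = sgn_vec h $ e / 2)"
    if "y \<in> cube" for y
    using inner_cube_eq_iff[OF that, of h] inner_pr[OF h, of y] by (simp add: sgn_vec_def sgn_eq_0_iff)
  then show ?thesis unfolding sign_face_def by auto
qed

lemma inner_pr_cube_le: "h \<in> H \<Longrightarrow> x \<in> pr ` cube \<Longrightarrow> h \<bullet> x \<le> (\<Sum>e\<in>UNIV. \<bar>h $ e\<bar>) / 2"
  using inner_cube_le inner_pr by auto

lemma half_in_cube: "s \<in> sign_vectors E \<Longrightarrow> (1/2) *\<^sub>R s \<in> cube"
proof -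
  assume "s \<in> sign_vectors E"
  then have "s $ e \<in> {-1, 0, 1}" for e by (simp add: sign_vectors_def)
  then have "\<bar>s $ e\<bar> \<le> 1" for e by (metis abs_0 abs_1 abs_minus_cancel empty_iff insert_iff order_refl zero_le_one)
  then show ?thesis by (simp add: cube_def)
qed

text \<open>The projected centre of the cube face. This single test point suffices to recover sign
  patterns from inclusions and translations of faces.\<close>

lemma pr_half_in_sign_face: "s \<in> sign_vectors E \<Longrightarrow> pr ((1/2) *\<^sub>R s) \<in> sign_face s"
  unfolding sign_face_def using half_in_cube by (intro imageI) simp

lemma sign_face_subset: "sign_face s \<subseteq> voronoi V E src tgt 0"
  unfolding voronoi_eq_pr_cube by (auto simp: sign_face_def)

lemma sign_face_of_voronoi:
  assumes "s \<in> SV"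
  shows "sign_face s face_of voronoi V E src tgt 0"
proof -
  obtain h where h: "h \<in> H" "s = sgn_vec h" using SV_eq_sgn_vec_flow[OF assms] by blast
  show ?thesis
    unfolding voronoi_eq_pr_cube h(2) sign_face_eq_hyperplane[OF h(1), symmetric]
    by (intro face_of_Int_supporting_hyperplane_le inner_pr_cube_le h(1))
      (simp_all add: polytope_imp_convex polytope_pr_cube)
qed

text \<open>Faces of a polytope are exposed, and projecting the exposing normal to \<open>H\<close>
  does not change it as a functional on the cell. The resulting flow \<open>h\<close> has the
  required sign pattern; \<open>h = 0\<close> gives the whole cell.\<close>

lemma face_of_voronoi_eq_sign_face:
  assumes F: "F face_of voronoi V E src tgt 0" "F \<noteq> {}"
  shows "\<exists>s\<in>SV. F = sign_face s"
proof -
  have "F exposed_face_of pr ` cube"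
    using F(1) exposed_face_of_polyhedron[OF polytope_imp_polyhedron[OF polytope_pr_cube]]
    by (simp add: voronoi_eq_pr_cube)
  then obtain a b where ab: "pr ` cube \<subseteq> {x. a \<bullet> x \<le> b}" "F = pr ` cube \<inter> {x. a \<bullet> x = b}"
    unfolding exposed_face_of_def by blast
  define h where "h = pr a"
  have h: "h \<in> H" by (simp add: h_def pr_in)
  have h_inner: "h \<bullet> pr y = a \<bullet> pr y" for y
    using inner_pr[OF pr_in, of y a] by (simp add: h_def inner_commute)
  \<comment> \<open>Since \<open>F\<close> is nonempty, \<open>b\<close> is the maximum of the
    functional, and that maximum is attained at the projection of half the sign vector of
    \<open>h\<close>.\<close>
  have "b = (\<Sum>e\<in>UNIV. \<bar>h $ e\<bar>) / 2"
  proof (rule antisym)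
    obtain y where y: "y \<in> cube" "a \<bullet> pr y = b" using F(2) ab(2) by auto
    then show "b \<le> (\<Sum>e\<in>UNIV. \<bar>h $ e\<bar>) / 2"
      using inner_pr_cube_le[OF h, of "pr y"] h_inner by auto
    have "(\<Sum>e\<in>UNIV. \<bar>h $ e\<bar>) / 2 = h \<bullet> ((1/2) *\<^sub>R sgn_vec h)" by (simp add: inner_sgn_vec)
    also have "\<dots> = a \<bullet> pr ((1/2) *\<^sub>R sgn_vec h)" using inner_pr[OF h] h_inner by metis
    also have "\<dots> \<le> b" using ab(1) half_sgn_vec_in_cube by blast
    finally show "(\<Sum>e\<in>UNIV. \<bar>h $ e\<bar>) / 2 \<le> b" .
  qed
  then have "F = pr ` cube \<inter> {x. h \<bullet> x = (\<Sum>e\<in>UNIV. \<bar>h $ e\<bar>) / 2}"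
    unfolding ab(2) using h_inner by auto
  then show ?thesis
    using sign_face_eq_hyperplane[OF h] sgn_vec_flow_in_SV[OF h] by blast
qed

text \<open>Although \<open>pr\<close> may identify points, lying in the face is the equality case
  for a flow \<open>h\<close> with pattern \<open>s\<close>, and this condition reads the same on
  \<open>y\<close>. So all preimages in the cube lie in the cube face of \<open>s\<close>.\<close>

lemma pr_in_sign_face_imp:
  assumes "s \<in> SV" "y \<in> cube" "pr y \<in> sign_face s" "s $ e \<noteq> 0"
  shows "y $ e = s $ e / 2"
proof -
  obtain h where h: "h \<in> H" "s = sgn_vec h" using SV_eq_sgn_vec_flow[OF assms(1)] by blast
  have "h \<bullet> y = (\<Sum>e\<in>UNIV. \<bar>h $ e\<bar>) / 2"
    using assms(3) inner_pr[OF h(1), of y]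
    unfolding h(2) sign_face_eq_hyperplane[OF h(1), symmetric] by simp
  then show ?thesis
    using inner_cube_eq_iff[OF assms(2)] assms(4) by (auto simp: h(2) sgn_vec_def sgn_eq_0_iff)
qed

section \<open>Inclusions and lattice translates of faces\<close>

lemma sign_face_antimono:
  assumes "\<And>e. s2 $ e \<noteq> 0 \<Longrightarrow> s1 $ e = s2 $ e"
  shows "sign_face s1 \<subseteq> sign_face s2"
  unfolding sign_face_def
proof (rule image_mono, rule subsetI)
  fix y assume "y \<in> {y \<in> cube. \<forall>e. s1 $ e \<noteq> 0 \<longrightarrow> y $ e = s1 $ e / 2}"
  then have y: "y \<in> cube" "\<And>e. s1 $ e \<noteq> 0 \<Longrightarrow> y $ e = s1 $ e / 2" by auto
  show "y \<in> {y \<in> cube. \<forall>e. s2 $ e \<noteq> 0 \<longrightarrow> y $ e = s2 $ e / 2}"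
  proof (intro CollectI conjI allI impI y(1))
    fix e assume "s2 $ e \<noteq> 0"
    then show "y $ e = s2 $ e / 2" using assms[of e] y(2)[of e] by simp
  qed
qed

lemma sign_face_subset_imp:
  assumes s1: "s1 \<in> sign_vectors E" and s2: "s2 \<in> SV" and sub: "sign_face s1 \<subseteq> sign_face s2" and e: "s2 $ e \<noteq> 0"
  shows "s1 $ e = s2 $ e"
  using pr_in_sign_face_imp[OF s2 half_in_cube[OF s1] subsetD[OF sub pr_half_in_sign_face[OF s1]] e] by simp

text \<open>The half-space of \<open>l\<close>, evaluated at the shifted point, gives
  \<open>l \<bullet> s + l \<bullet> l \<le> 0\<close>. Integrality of \<open>l\<close> and
  \<open>\<bar>s $ e\<bar> \<le> 1\<close> make every coordinate of this sum nonnegative, so each of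
  them is 0.\<close>

lemma shift_into_voronoi:
  assumes s: "s \<in> sign_vectors E" and l: "l \<in> L"
    and shift: "pr ((1/2) *\<^sub>R s) + l \<in> voronoi V E src tgt 0" and e: "l $ e \<noteq> 0"
  shows "l $ e = - (s $ e)"
proof -
  have lH: "l \<in> H" using l by (simp add: int_flows_iff)
  have "2 * (l \<bullet> (pr ((1/2) *\<^sub>R s) + l)) \<le> l \<bullet> l" using shift l by (simp add: voronoi_0_iff)
  then have le: "l \<bullet> s + l \<bullet> l \<le> 0" by (simp add: inner_add_right inner_pr[OF lH])
  have ge: "0 \<le> l $ e * s $ e + l $ e * l $ e" for e
  proof -
    have "s $ e \<in> {-1, 0, 1}" using s by (simp add: sign_vectors_def)
    then show ?thesis using int_flow_abs_le[OF l, of e] by auto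
  qed
  have "l \<bullet> s + l \<bullet> l = (\<Sum>e\<in>UNIV. l $ e * s $ e + l $ e * l $ e)"
    by (simp add: inner_vec_def sum.distrib)
  moreover have "0 \<le> (\<Sum>e\<in>UNIV. l $ e * s $ e + l $ e * l $ e)" using ge by (intro sum_nonneg) auto
  ultimately have "(\<Sum>e\<in>UNIV. l $ e * s $ e + l $ e * l $ e) = 0" using le by linarith
  then have "l $ e * s $ e + l $ e * l $ e = 0"
    using ge by (subst (asm) sum_nonneg_eq_0_iff) auto
  then have "l $ e * (s $ e + l $ e) = 0" by (simp add: distrib_left)
  then show ?thesis using e by simp
qed

text \<open>Adding \<open>2 l\<close> reverses \<open>s\<close> on the support of \<open>l\<close>
  and leaves it alone elsewhere. The factor 2 matches the cube coordinates \<open>s $ e / 2\<close>: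
  shifting by \<open>l\<close> carries one cube face onto the other, and \<open>pr\<close> commutes
  with this shift because \<open>l\<close> is a flow.\<close>

lemma
  assumes s: "s \<in> SV" and l: "l \<in> H" and flip: "\<And>e. l $ e \<noteq> 0 \<Longrightarrow> l $ e = - (s $ e)"
  shows flip_in_SV: "s + 2 *\<^sub>R l \<in> SV"
    and sign_face_flip: "sign_face (s + 2 *\<^sub>R l) = (\<lambda>x. x + l) ` sign_face s"
proof -
  have fe: "(s + 2 *\<^sub>R l) $ e = s $ e \<and> l $ e = 0 \<or> (s + 2 *\<^sub>R l) $ e = - (s $ e) \<and> l $ e = - (s $ e)" for e
    using flip[of e] by (cases "l $ e = 0") auto
  have sv: "s \<in> sign_vectors E" "cut_strong s" using s by (auto simp: SV_def)
  have "(s + 2 *\<^sub>R l) $ e \<in> {-1, 0, 1}" for e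
    using fe[of e] sv(1) by (auto simp: sign_vectors_def)
  moreover have "is_chain E (s + 2 *\<^sub>R l)"
    using sv(1) l by (simp add: sign_vectors_def is_chain_def flows_iff)
  moreover have "cut_strong (s + 2 *\<^sub>R l)"
    by (rule cut_strong_shift[OF sv(2) l]) (use fe in \<open>metis abs_minus_cancel\<close>)
  ultimately show "s + 2 *\<^sub>R l \<in> SV" by (simp add: SV_def sign_vectors_def)
  let ?A = "{y \<in> cube. \<forall>e. s $ e \<noteq> 0 \<longrightarrow> y $ e = s $ e / 2}"
  let ?B = "{y \<in> cube. \<forall>e. (s + 2 *\<^sub>R l) $ e \<noteq> 0 \<longrightarrow> y $ e = (s + 2 *\<^sub>R l) $ e / 2}"
  have s1: "\<bar>s $ e\<bar> \<le> 1" for e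
    using half_in_cube[OF sv(1)] by (simp add: cube_def)
  have "?B = (\<lambda>y. y + l) ` ?A"
  proof (intro set_eqI iffI)
    fix y assume y: "y \<in> ?B"
    have eq: "(y - l) $ e = s $ e / 2" if "s $ e \<noteq> 0" for e
      using y fe[of e] that by auto
    have "\<bar>(y - l) $ e\<bar> \<le> 1/2" for e
    proof (cases "s $ e = 0")
      case True
      then show ?thesis using y fe[of e] by (simp add: cube_def)
    next
      case False
      show ?thesis unfolding eq[OF False] using s1[of e] by simp
    qed
    then have "y - l \<in> ?A" using eq by (simp add: cube_def)
    then show "y \<in> (\<lambda>y. y + l) ` ?A" by (intro image_eqI[where x="y - l"]) simp_all
  next
    fix z assume "z \<in> (\<lambda>y. y + l) ` ?A"
    then obtain y where y: "y \<in> ?A" "z = y + l" by blast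
    have eq: "z $ e = (s + 2 *\<^sub>R l) $ e / 2" if "s $ e \<noteq> 0" for e
      using y that by simp
    have "\<bar>z $ e\<bar> \<le> 1/2" for e
    proof (cases "s $ e = 0")
      case True
      then show ?thesis using y fe[of e] by (simp add: cube_def)
    next
      case False
      have "\<bar>(s + 2 *\<^sub>R l) $ e\<bar> \<le> 1" using fe[of e] s1[of e] by (metis abs_minus_cancel)
      then show ?thesis unfolding eq[OF False] by simp
    qed
    moreover have "(s + 2 *\<^sub>R l) $ e \<noteq> 0 \<Longrightarrow> s $ e \<noteq> 0" for e using fe[of e] by auto
    ultimately show "z \<in> ?B" using eq by (simp add: cube_def)
  qed
  then have "sign_face (s + 2 *\<^sub>R l) = pr ` (\<lambda>y. y + l) ` ?A" by (simp add: sign_face_def)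
  also have "\<dots> = (\<lambda>x. x + l) ` pr ` ?A"
    unfolding image_image using linear_add[OF linear_pr] pr_ident[OF l] by simp
  finally show "sign_face (s + 2 *\<^sub>R l) = (\<lambda>x. x + l) ` sign_face s" by (simp add: sign_face_def)
qed

text \<open>A translate that stays inside the cell forces \<open>l\<close> to be a reversal of part
  of \<open>s1\<close>, so the translate is itself a sign face and the inclusion becomes an
  extension of sign patterns.\<close>

lemma sign_face_translate_subset:
  assumes s1: "s1 \<in> SV" and s2: "s2 \<in> SV" and l: "l \<in> L"
    and sub: "(\<lambda>x. x + l) ` sign_face s1 \<subseteq> sign_face s2"
  shows "s1 + 2 *\<^sub>R l \<in> SV" "sign_face (s1 + 2 *\<^sub>R l) = (\<lambda>x. x + l) ` sign_face s1"
    "s2 $ e \<noteq> 0 \<Longrightarrow> (s1 + 2 *\<^sub>R l) $ e = s2 $ e"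
proof -
  have sv: "s1 \<in> sign_vectors E" using s1 by (simp add: SV_def)
  have lH: "l \<in> H" using l by (simp add: int_flows_iff)
  have "pr ((1/2) *\<^sub>R s1) + l \<in> voronoi V E src tgt 0"
    using sub pr_half_in_sign_face[OF sv] sign_face_subset by blast
  then have flip: "l $ e \<noteq> 0 \<Longrightarrow> l $ e = - (s1 $ e)" for e
    by (rule shift_into_voronoi[OF sv l])
  show SV: "s1 + 2 *\<^sub>R l \<in> SV" by (rule flip_in_SV[OF s1 lH flip])
  show eq: "sign_face (s1 + 2 *\<^sub>R l) = (\<lambda>x. x + l) ` sign_face s1"
    by (rule sign_face_flip[OF s1 lH flip])
  show "(s1 + 2 *\<^sub>R l) $ e = s2 $ e" if "s2 $ e \<noteq> 0"
    using SV sub that by (intro sign_face_subset_imp[OF _ s2 _ that]) (simp_all add: eq SV_def)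
qed

text \<open>Equality of faces is used as two inclusions: each determines the entries where the
  pattern of the larger face is nonzero, and together they give \<open>t = s + 2 l\<close>.\<close>

lemma sign_face_translate_iff:
  assumes s: "s \<in> SV" and t: "t \<in> SV"
  shows "(\<exists>l\<in>L. sign_face t = (\<lambda>x. x + l) ` sign_face s)
    \<longleftrightarrow> {e. s $ e \<noteq> 0} = {e. t $ e \<noteq> 0} \<and> s - t \<in> H"
proof
  assume "\<exists>l\<in>L. sign_face t = (\<lambda>x. x + l) ` sign_face s"
  then obtain l where l: "l \<in> L" "sign_face t = (\<lambda>x. x + l) ` sign_face s" by blast
  have lH: "l \<in> H" using l(1) by (simp add: int_flows_iff)
  have sub: "(\<lambda>x. x + l) ` sign_face s \<subseteq> sign_face t" using l(2) by simp
  note tr = sign_face_translate_subset[OF s t l(1) sub]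
  have "(s + 2 *\<^sub>R l) $ e = t $ e" for e
  proof (cases "(s + 2 *\<^sub>R l) $ e = 0")
    case True
    then show ?thesis using tr(3)[of e] by auto
  next
    case False
    have "t \<in> sign_vectors E" using t by (simp add: SV_def)
    moreover have "sign_face t \<subseteq> sign_face (s + 2 *\<^sub>R l)" using tr(2) l(2) by simp
    ultimately show ?thesis using sign_face_subset_imp[OF _ tr(1) _ False] by metis
  qed
  then have t_eq: "t = s + 2 *\<^sub>R l" by (simp add: vec_eq_iff)
  have "pr ((1/2) *\<^sub>R s) + l \<in> voronoi V E src tgt 0"
    using sub pr_half_in_sign_face[of s] s sign_face_subset unfolding SV_def by blast
  then have flip: "l $ e \<noteq> 0 \<Longrightarrow> l $ e = - (s $ e)" for e
    using s l(1) by (intro shift_into_voronoi) (auto simp: SV_def)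
  have "s $ e \<noteq> 0 \<longleftrightarrow> t $ e \<noteq> 0" for e
    using flip[of e] by (cases "l $ e = 0") (auto simp: t_eq)
  moreover have "s - t = (- 2) *\<^sub>R l" by (simp add: t_eq)
  then have "s - t \<in> H" using subspace_scale[OF subspace_flows lH] by metis
  ultimately show "{e. s $ e \<noteq> 0} = {e. t $ e \<noteq> 0} \<and> s - t \<in> H" by simp
next
  assume a: "{e. s $ e \<noteq> 0} = {e. t $ e \<noteq> 0} \<and> s - t \<in> H"
  \<comment> \<open>Solves \<open>s + 2 l = t\<close>. With equal supports, \<open>t\<close> agrees
    with \<open>s\<close> or with its negative at each edge, so the entries of \<open>l\<close> are
    0 or \<open>- (s $ e)\<close> and \<open>l\<close> is integral.\<close>
  define l where "l = (- 1/2) *\<^sub>R (s - t)"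
  have lH: "l \<in> H" unfolding l_def using a subspace_scale[OF subspace_flows] by blast
  have cases: "l $ e = 0 \<or> l $ e = - (s $ e) \<and> s $ e \<in> {-1, 1}" for e
  proof -
    have "s $ e \<in> {-1, 0, 1}" "t $ e \<in> {-1, 0, 1}" using s t by (simp_all add: SV_def sign_vectors_def)
    moreover have "s $ e = 0 \<longleftrightarrow> t $ e = 0" using a by blast
    ultimately show ?thesis by (auto simp: l_def)
  qed
  have "l $ e \<in> \<int>" for e using cases[of e] by auto
  then have "l \<in> L" using lH by (simp add: int_flows_iff)
  moreover have "s + 2 *\<^sub>R l = t" by (simp add: l_def)
  moreover have "sign_face (s + 2 *\<^sub>R l) = (\<lambda>x. x + l) ` sign_face s"
    using cases by (intro sign_face_flip[OF s lH]) blast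
  ultimately show "\<exists>l\<in>L. sign_face t = (\<lambda>x. x + l) ` sign_face s" by metis
qed

subsection \<open>Orientations as sign vectors\<close>

definition orient_vec :: "('e \<times> bool) set \<Rightarrow> real ^ 'e" where
  "orient_vec D = (\<chi> e. of_bool ((e, True) \<in> D) - of_bool ((e, False) \<in> D))"

lemma
  assumes "is_orientation H0 D"
  shows mem_orientation_iff: "(e, b) \<in> D \<longleftrightarrow> orient_vec D $ e = (if b then 1 else - 1)"
    and support_orient_vec: "e \<in> H0 \<longleftrightarrow> orient_vec D $ e \<noteq> 0"
    and orient_vec_range: "orient_vec D $ e \<in> {-1, 0, 1}"
proof -
  have "e \<notin> H0 \<and> (e, True) \<notin> D \<and> (e, False) \<notin> D \<or> e \<in> H0 \<and> ((e, True) \<in> D \<longleftrightarrow> (e, False) \<notin> D)"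
  proof (cases "e \<in> H0")
    case True
    then obtain b' where "(e, b') \<in> D" "\<And>c. (e, c) \<in> D \<Longrightarrow> c = b'"
      using assms unfolding is_orientation_def by blast
    then show ?thesis using True by (cases b') auto
  next
    case False
    then show ?thesis using assms by (auto simp: is_orientation_def arcs_def)
  qed
  then show "(e, b) \<in> D \<longleftrightarrow> orient_vec D $ e = (if b then 1 else - 1)"
    "e \<in> H0 \<longleftrightarrow> orient_vec D $ e \<noteq> 0" "orient_vec D $ e \<in> {-1, 0, 1}"
    by (cases b; auto simp: orient_vec_def)+
qed

text \<open>A directed path cannot leave a set closed under outgoing arcs, which gives one
  direction. For the other, the set reachable from the head of an arc must contain its tail, so
  every arc can be undone by a directed path.\<close>

lemma strongly_connected_iff_closed:
  "strongly_connected src tgt D \<longleftrightarrow>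
    (\<forall>S. (\<forall>a\<in>D. arc_tail src tgt a \<in> S \<longrightarrow> arc_head src tgt a \<in> S)
      \<longrightarrow> (\<forall>a\<in>D. arc_head src tgt a \<in> S \<longrightarrow> arc_tail src tgt a \<in> S))"
  (is "_ \<longleftrightarrow> ?R")
proof
  let ?A = "arc_rel src tgt D"
  assume sc: "strongly_connected src tgt D"
  show ?R
  proof (intro allI impI ballI)
    fix S a
    assume closed: "\<forall>a\<in>D. arc_tail src tgt a \<in> S \<longrightarrow> arc_head src tgt a \<in> S"
      and a: "a \<in> D" "arc_head src tgt a \<in> S"
    have "(arc_tail src tgt a, arc_head src tgt a) \<in> ?A" using a(1) unfolding arc_rel_def by blast
    then have "(arc_head src tgt a, arc_tail src tgt a) \<in> (?A \<union> ?A\<inverse>)\<^sup>*" by blast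
    then have "(arc_head src tgt a, arc_tail src tgt a) \<in> ?A\<^sup>*"
      using sc unfolding strongly_connected_def by blast
    then show "arc_tail src tgt a \<in> S"
      by (induction rule: rtrancl_induct) (use a(2) closed in \<open>auto simp: arc_rel_def\<close>)
  qed
next
  let ?A = "arc_rel src tgt D"
  assume r: ?R
  have "?A\<inverse> \<subseteq> ?A\<^sup>*"
  proof
    fix x assume "x \<in> ?A\<inverse>"
    then obtain a where a: "a \<in> D" "x = (arc_head src tgt a, arc_tail src tgt a)"
      by (auto simp: arc_rel_def)
    define S where "S = ?A\<^sup>* `` {arc_head src tgt a}"
    have "arc_head src tgt a' \<in> S" if "a' \<in> D" "arc_tail src tgt a' \<in> S" for a'
    proof -
      have "(arc_tail src tgt a', arc_head src tgt a') \<in> ?A" using that(1) unfolding arc_rel_def by blast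
      then show ?thesis using that(2) by (auto simp: S_def intro: rtrancl_into_rtrancl)
    qed
    moreover have "arc_head src tgt a \<in> S" by (simp add: S_def)
    ultimately have "arc_tail src tgt a \<in> S" using r a(1) by blast
    then show "x \<in> ?A\<^sup>*" by (simp add: S_def a(2))
  qed
  then have "(?A \<union> ?A\<inverse>)\<^sup>* \<subseteq> ?A\<^sup>*"
    using rtrancl_subset_rtrancl[of "?A \<union> ?A\<inverse>" ?A] by blast
  then show "strongly_connected src tgt D" by (auto simp: strongly_connected_def)
qed

text \<open>For an arc of \<open>D\<close> the cut term is 1 if it leaves \<open>S\<close>, -1 if it
  enters \<open>S\<close> and 0 otherwise. Nonpositive terms say that \<open>S\<close> is closed
  under outgoing arcs; vanishing terms then say that no arc enters.\<close>

lemma strongly_connected_iff_cut_strong: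
  assumes D: "is_orientation H0 D"
  shows "strongly_connected src tgt D \<longleftrightarrow> cut_strong (orient_vec D)"
proof -
  define arc_term where "arc_term S e = orient_vec D $ e * gr (\<lambda>v. of_bool (v \<in> S)) $ e" for S e
  have arc: "arc_term S (fst a) = of_bool (arc_tail src tgt a \<in> S) - of_bool (arc_head src tgt a \<in> S)" if "a \<in> D" for S a
    using that mem_orientation_iff[OF D, of "fst a" "snd a"]
    by (simp add: arc_term_def grad_def arc_tail_def arc_head_def)
  have none: "arc_term S e = 0" if "e \<notin> fst ` D" for S e
  proof -
    have "(e, True) \<notin> D" "(e, False) \<notin> D" using that by force+
    then show ?thesis by (simp add: arc_term_def orient_vec_def)
  qed
  have le: "(\<forall>e. arc_term S e \<le> 0) \<longleftrightarrow> (\<forall>a\<in>D. arc_tail src tgt a \<in> S \<longrightarrow> arc_head src tgt a \<in> S)" for S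
  proof
    assume l: "\<forall>e. arc_term S e \<le> 0"
    show "\<forall>a\<in>D. arc_tail src tgt a \<in> S \<longrightarrow> arc_head src tgt a \<in> S"
    proof
      fix a assume "a \<in> D"
      then show "arc_tail src tgt a \<in> S \<longrightarrow> arc_head src tgt a \<in> S"
        using l[rule_format, of "fst a"] unfolding arc[OF \<open>a \<in> D\<close>] by auto
    qed
  next
    assume l: "\<forall>a\<in>D. arc_tail src tgt a \<in> S \<longrightarrow> arc_head src tgt a \<in> S"
    show "\<forall>e. arc_term S e \<le> 0"
    proof
      fix e show "arc_term S e \<le> 0"
      proof (cases "e \<in> fst ` D")
        case True
        then obtain a where "a \<in> D" "e = fst a" by blast
        then show ?thesis using l arc by auto
      qed (simp add: none)
    qed
  qed
  have eq: "(\<forall>e. arc_term S e = 0) \<longleftrightarrow> (\<forall>a\<in>D. arc_head src tgt a \<in> S \<longrightarrow> arc_tail src tgt a \<in> S)"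
    if "\<forall>e. arc_term S e \<le> 0" for S
  proof
    assume l: "\<forall>e. arc_term S e = 0"
    show "\<forall>a\<in>D. arc_head src tgt a \<in> S \<longrightarrow> arc_tail src tgt a \<in> S"
    proof
      fix a assume "a \<in> D"
      then show "arc_head src tgt a \<in> S \<longrightarrow> arc_tail src tgt a \<in> S"
        using l[rule_format, of "fst a"] unfolding arc[OF \<open>a \<in> D\<close>] by auto
    qed
  next
    assume l: "\<forall>a\<in>D. arc_head src tgt a \<in> S \<longrightarrow> arc_tail src tgt a \<in> S"
    show "\<forall>e. arc_term S e = 0"
    proof
      fix e show "arc_term S e = 0"
      proof (cases "e \<in> fst ` D")
        case True
        then obtain a where "a \<in> D" "e = fst a" by blast
        then show ?thesis using l arc that le by auto
      qed (simp add: none)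
    qed
  qed
  show ?thesis
    unfolding strongly_connected_iff_closed cut_strong_def arc_term_def[symmetric]
    using le eq by meson
qed

lemma SC_iff: "(H0, D) \<in> SC E src tgt \<longleftrightarrow> is_orientation H0 D \<and> orient_vec D \<in> SV"
proof (cases "is_orientation H0 D")
  case True
  have "H0 \<subseteq> E \<longleftrightarrow> orient_vec D \<in> sign_vectors E"
    using support_orient_vec[OF True] orient_vec_range[OF True]
    unfolding sign_vectors_def is_chain_def by blast
  then show ?thesis
    using strongly_connected_iff_cut_strong[OF True] True by (auto simp: SC_def SV_def)
qed (simp add: SC_def)

lemma orient_vec_surj:
  assumes "s \<in> SV"
  shows "\<exists>p\<in>SC E src tgt. orient_vec (snd p) = s"
proof -
  define D where "D = {(e, b). s $ e = (if b then 1 else - 1)}"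
  have r: "s $ e \<in> {-1, 0, 1}" for e using assms by (simp add: SV_def sign_vectors_def)
  have "orient_vec D $ e = s $ e" for e using r[of e] by (auto simp: orient_vec_def D_def)
  then have eq: "orient_vec D = s" by (simp add: vec_eq_iff)
  have "is_orientation {e. s $ e \<noteq> 0} D"
    unfolding is_orientation_def
  proof (intro conjI ballI)
    show "D \<subseteq> arcs {e. s $ e \<noteq> 0}" by (auto simp: D_def arcs_def)
    fix e assume "e \<in> {e. s $ e \<noteq> 0}"
    then have "s $ e = 1 \<or> s $ e = - 1" using r[of e] by auto
    then show "\<exists>!b. (e, b) \<in> D" by (intro ex1I[of _ "s $ e = 1"]) (auto simp: D_def split: if_splits)
  qed
  then have "({e. s $ e \<noteq> 0}, D) \<in> SC E src tgt" using eq assms by (simp add: SC_iff)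
  then show ?thesis using eq by (intro bexI[of _ "({e. s $ e \<noteq> 0}, D)"]) simp_all
qed

text \<open>Out-degree plus in-degree is the degree in \<open>H0\<close>, with loops counted twice,
  and out-degree minus in-degree is the divergence of \<open>orient_vec D\<close>. Only the second
  depends on the orientation.\<close>

lemma outdeg_eq:
  assumes D: "is_orientation H0 D"
  shows "2 * real (outdeg src tgt D v) =
    (\<Sum>e\<in>H0. of_bool (src e = v) + of_bool (tgt e = v)) + orient_vec D \<bullet> gr (\<lambda>w. of_bool (w = v))"
proof -
  let ?h = "\<lambda>e. (e, orient_vec D $ e = 1)"
  have mem: "?h e \<in> D \<longleftrightarrow> e \<in> H0" for e
    using mem_orientation_iff[OF D, of e] support_orient_vec[OF D, of e] orient_vec_range[OF D, of e] by auto
  have sgn: "(e, b) \<in> D \<Longrightarrow> b = (orient_vec D $ e = 1) \<and> e \<in> H0" for e b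
    using mem_orientation_iff[OF D, of e b] support_orient_vec[OF D, of e] by auto
  have "{a \<in> D. arc_tail src tgt a = v} = ?h ` {e \<in> H0. arc_tail src tgt (?h e) = v}"
    using mem sgn by (auto simp: image_iff)
  then have "outdeg src tgt D v = card {e \<in> H0. arc_tail src tgt (?h e) = v}"
    unfolding outdeg_def by (simp add: card_image inj_on_def)
  then have "2 * real (outdeg src tgt D v) = (\<Sum>e\<in>H0. 2 * of_bool (arc_tail src tgt (?h e) = v))"
    by (simp add: sum_distrib_left[symmetric] of_bool_def sum.If_cases Collect_conj_eq)
  also have "\<dots> = (\<Sum>e\<in>H0. (of_bool (src e = v) + of_bool (tgt e = v)) + orient_vec D $ e * gr (\<lambda>w. of_bool (w = v)) $ e)"
  proof (rule sum.cong[OF refl])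
    fix e assume "e \<in> H0"
    then have "orient_vec D $ e \<in> {-1, 1}"
      using support_orient_vec[OF D, of e] orient_vec_range[OF D, of e] by auto
    then show "2 * of_bool (arc_tail src tgt (?h e) = v) =
      (of_bool (src e = v) + of_bool (tgt e = v)) + orient_vec D $ e * gr (\<lambda>w. of_bool (w = v)) $ e"
      by (auto simp: arc_tail_def grad_def)
  qed
  also have "\<dots> = (\<Sum>e\<in>H0. of_bool (src e = v) + of_bool (tgt e = v)) + orient_vec D \<bullet> gr (\<lambda>w. of_bool (w = v))"
  proof -
    have "(\<Sum>e\<in>H0. orient_vec D $ e * gr (\<lambda>w. of_bool (w = v)) $ e) = orient_vec D \<bullet> gr (\<lambda>w. of_bool (w = v))"
      unfolding inner_vec_def inner_real_def
      by (rule sum.mono_neutral_left) (use support_orient_vec[OF D] in auto)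
    then show ?thesis by (simp only: sum.distrib)
  qed
  finally show ?thesis .
qed

text \<open>On a common support the degree terms of \<open>outdeg_eq\<close> cancel, so equal
  out-degrees mean that \<open>s - t\<close> has no divergence. The right side is the condition of
  \<open>sign_face_translate_iff\<close>, which is how the two equivalence relations are
  matched.\<close>

lemma SC_rel_iff:
  assumes p: "p \<in> SC E src tgt" and q: "q \<in> SC E src tgt"
  defines "s \<equiv> orient_vec (snd p)" and "t \<equiv> orient_vec (snd q)"
  shows "(p, q) \<in> SC_rel E src tgt \<longleftrightarrow> {e. s $ e \<noteq> 0} = {e. t $ e \<noteq> 0} \<and> s - t \<in> H"
proof -
  have po: "is_orientation (fst p) (snd p)" "s \<in> SV" and qo: "is_orientation (fst q) (snd q)" "t \<in> SV"
    using SC_iff[of "fst p" "snd p"] SC_iff[of "fst q" "snd q"] p q by (simp_all add: s_def t_def)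
  have supp: "fst p = {e. s $ e \<noteq> 0}" "fst q = {e. t $ e \<noteq> 0}"
    using support_orient_vec[OF po(1)] support_orient_vec[OF qo(1)] by (auto simp: s_def t_def)
  have chain: "is_chain E (s - t)"
    using po(2) qo(2) by (simp add: SV_def sign_vectors_def is_chain_def)
  have "outdeg src tgt (snd p) = outdeg src tgt (snd q) \<longleftrightarrow> s - t \<in> H" if eq: "fst p = fst q"
  proof -
    have v: "outdeg src tgt (snd p) v = outdeg src tgt (snd q) v \<longleftrightarrow> (s - t) \<bullet> gr (\<lambda>w. of_bool (w = v)) = 0" for v
    proof -
      have "real (outdeg src tgt (snd p) v) = real (outdeg src tgt (snd q) v)
          \<longleftrightarrow> s \<bullet> gr (\<lambda>w. of_bool (w = v)) = t \<bullet> gr (\<lambda>w. of_bool (w = v))"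
        using outdeg_eq[OF po(1), of v] outdeg_eq[OF qo(1), of v] eq unfolding s_def t_def by auto
      then show ?thesis by (simp add: inner_diff_left)
    qed
    show ?thesis
    proof
      assume "outdeg src tgt (snd p) = outdeg src tgt (snd q)"
      then have "\<forall>v\<in>V. (s - t) \<bullet> gr (\<lambda>w. of_bool (w = v)) = 0" using v by simp
      then show "s - t \<in> H" unfolding flows_def using chain divergence_eq[OF chain] by simp
    next
      assume "s - t \<in> H"
      then show "outdeg src tgt (snd p) = outdeg src tgt (snd q)" using v by (auto simp: flows_iff)
    qed
  qed
  then show ?thesis using p q unfolding SC_rel_def supp[symmetric] by auto
qed

lemma SC_le_iff:
  assumes "p \<in> SC E src tgt" "q \<in> SC E src tgt"
  shows "SC_le p q \<longleftrightarrow>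
    (\<forall>e. orient_vec (snd q) $ e \<noteq> 0 \<longrightarrow> orient_vec (snd p) $ e = orient_vec (snd q) $ e)"
proof -
  have p: "is_orientation (fst p) (snd p)" and q: "is_orientation (fst q) (snd q)"
    using SC_iff[of "fst p" "snd p"] SC_iff[of "fst q" "snd q"] assms by simp_all
  show ?thesis
  proof
    assume le: "SC_le p q"
    show "\<forall>e. orient_vec (snd q) $ e \<noteq> 0 \<longrightarrow> orient_vec (snd p) $ e = orient_vec (snd q) $ e"
    proof (intro allI impI)
      fix e assume "orient_vec (snd q) $ e \<noteq> 0"
      then have "e \<in> fst q" using support_orient_vec[OF q] by simp
      then have "(e, b) \<in> snd q \<longleftrightarrow> (e, b) \<in> snd p" for b using le by (auto simp: SC_le_def)
      then show "orient_vec (snd p) $ e = orient_vec (snd q) $ e" by (simp add: orient_vec_def)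
    qed
  next
    assume r: "\<forall>e. orient_vec (snd q) $ e \<noteq> 0 \<longrightarrow> orient_vec (snd p) $ e = orient_vec (snd q) $ e"
    have "fst q \<subseteq> fst p"
    proof
      fix e assume "e \<in> fst q"
      then show "e \<in> fst p" using r support_orient_vec[OF q, of e] support_orient_vec[OF p, of e] by simp
    qed
    moreover have "(e, b) \<in> snd q \<longleftrightarrow> (e, b) \<in> snd p \<and> e \<in> fst q" for e b
      using r[rule_format, of e] support_orient_vec[OF q, of e]
        mem_orientation_iff[OF p, of e b] mem_orientation_iff[OF q, of e b] by auto
    ultimately show "SC_le p q" by (auto simp: SC_le_def)
  qed
qed

subsection \<open>The isomorphism of quotient posets\<close>

abbreviation "face p \<equiv> sign_face (orient_vec (snd p))"

lemma orient_vec_SV: "p \<in> SC E src tgt \<Longrightarrow> orient_vec (snd p) \<in> SV"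
  using SC_iff[of "fst p" "snd p"] by simp

lemma face_in_FP: "p \<in> SC E src tgt \<Longrightarrow> face p \<in> FP_faces V E src tgt"
  using sign_face_of_voronoi[OF orient_vec_SV] pr_half_in_sign_face zero_int_flows orient_vec_SV
  unfolding FP_faces_def SV_def by blast

lemma equiv_FP_rel: "equiv (FP_faces V E src tgt) (FP_rel V E src tgt)"
proof (rule equivI)
  show "FP_rel V E src tgt \<subseteq> FP_faces V E src tgt \<times> FP_faces V E src tgt" by (auto simp: FP_rel_def)
  show "refl_on (FP_faces V E src tgt) (FP_rel V E src tgt)"
    using zero_int_flows by (auto simp: refl_on_def FP_rel_def intro!: bexI[of _ 0])
  show "sym (FP_rel V E src tgt)"
  proof (rule symI)
    fix F G assume FG: "(F, G) \<in> FP_rel V E src tgt"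
    then obtain l where l: "l \<in> L" "G = (\<lambda>x. x + l) ` F" by (auto simp: FP_rel_def)
    have "0 - l \<in> L" by (rule diff_int_flows[OF zero_int_flows l(1)])
    moreover have "F = (\<lambda>x. x + (0 - l)) ` G" by (simp add: l(2) image_image)
    moreover have "F \<in> FP_faces V E src tgt" "G \<in> FP_faces V E src tgt" using FG by (simp_all add: FP_rel_def)
    ultimately show "(G, F) \<in> FP_rel V E src tgt"
      unfolding FP_rel_def by (intro CollectI case_prodI conjI bexI)
  qed
  show "trans (FP_rel V E src tgt)"
  proof (rule transI)
    fix F G K assume FG: "(F, G) \<in> FP_rel V E src tgt" and GK: "(G, K) \<in> FP_rel V E src tgt"
    obtain l where l: "l \<in> L" "G = (\<lambda>x. x + l) ` F" using FG by (auto simp: FP_rel_def)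
    obtain m where m: "m \<in> L" "K = (\<lambda>x. x + m) ` G" using GK by (auto simp: FP_rel_def)
    have "K = (\<lambda>x. x + (l + m)) ` F" by (simp add: m(2) l(2) image_image add.assoc)
    moreover have "F \<in> FP_faces V E src tgt" "K \<in> FP_faces V E src tgt"
      using FG GK by (simp_all add: FP_rel_def)
    ultimately show "(F, K) \<in> FP_rel V E src tgt"
      using add_int_flows[OF l(1) m(1)] unfolding FP_rel_def by (intro CollectI case_prodI conjI bexI)
  qed
qed

lemma equiv_SC_rel: "equiv (SC E src tgt) (SC_rel E src tgt)"
proof (rule equivI)
  show "SC_rel E src tgt \<subseteq> SC E src tgt \<times> SC E src tgt" unfolding SC_rel_def by blast
  show "refl_on (SC E src tgt) (SC_rel E src tgt)" by (rule refl_onI) (simp add: SC_rel_def)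
  show "sym (SC_rel E src tgt)" by (rule symI) (simp add: SC_rel_def)
  show "trans (SC_rel E src tgt)" by (rule transI) (simp add: SC_rel_def)
qed

lemma face_rel_iff:
  assumes "p \<in> SC E src tgt" "q \<in> SC E src tgt"
  shows "(face p, face q) \<in> FP_rel V E src tgt \<longleftrightarrow> (p, q) \<in> SC_rel E src tgt"
proof -
  have "(face p, face q) \<in> FP_rel V E src tgt \<longleftrightarrow> (\<exists>l\<in>L. face q = (\<lambda>x. x + l) ` face p)"
    using face_in_FP assms unfolding FP_rel_def by blast
  then show ?thesis
    unfolding SC_rel_iff[OF assms] sign_face_translate_iff[OF assms[THEN orient_vec_SV]] .
qed

text \<open>Subtracting the lattice point \<open>l\<close> moves the face to the cell at the origin,
  whose faces are all sign faces.\<close>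

lemma FP_face_rel_face:
  assumes F: "F \<in> FP_faces V E src tgt"
  shows "\<exists>p\<in>SC E src tgt. (face p, F) \<in> FP_rel V E src tgt"
proof -
  obtain l where l: "l \<in> L" "F face_of voronoi V E src tgt l" "F \<noteq> {}"
    using F by (auto simp: FP_faces_def)
  define F0 where "F0 = (+) (- l) ` F"
  have F_eq: "F = (+) l ` F0" by (simp add: F0_def image_image)
  have "F0 face_of voronoi V E src tgt 0"
    using l(2) unfolding voronoi_translate[OF l(1)] F_eq by (simp only: face_of_translation_eq)
  moreover have "F0 \<noteq> {}" using l(3) by (simp add: F0_def)
  ultimately obtain s where s: "s \<in> SV" "F0 = sign_face s" using face_of_voronoi_eq_sign_face by blast
  obtain p where p: "p \<in> SC E src tgt" "orient_vec (snd p) = s" using orient_vec_surj[OF s(1)] by blast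
  have "F = (\<lambda>x. x + l) ` face p" unfolding F_eq s(2) p(2) by (simp add: add.commute)
  then have "(face p, F) \<in> FP_rel V E src tgt"
    using F face_in_FP[OF p(1)] l(1) unfolding FP_rel_def by blast
  then show ?thesis using p(1) by blast
qed

lemma FPbar_le_iff:
  assumes C: "C1 \<in> FPbar V E src tgt" "C2 \<in> FPbar V E src tgt"
  shows "FPbar_le C1 C2 \<longleftrightarrow> SCbar_le {p \<in> SC E src tgt. face p \<in> C1} {p \<in> SC E src tgt. face p \<in> C2}"
proof
  have closed: "F \<in> C \<longleftrightarrow> G \<in> C" if "C \<in> FPbar V E src tgt" "(F, G) \<in> FP_rel V E src tgt" for C F G
    using that equiv_FP_rel in_quotient_imp_closed[OF equiv_FP_rel] unfolding FPbar_def equiv_def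
    by (meson symD)
  assume "FPbar_le C1 C2"
  then obtain F1 F2 where F: "F1 \<in> C1" "F2 \<in> C2" "F1 \<subseteq> F2" by (auto simp: FPbar_le_def)
  have "F1 \<in> FP_faces V E src tgt" "F2 \<in> FP_faces V E src tgt"
    using F C in_quotient_imp_subset[OF equiv_FP_rel] unfolding FPbar_def by blast+
  then obtain p1 p2 where p: "p1 \<in> SC E src tgt" "(face p1, F1) \<in> FP_rel V E src tgt"
    "p2 \<in> SC E src tgt" "(face p2, F2) \<in> FP_rel V E src tgt" using FP_face_rel_face by meson
  obtain l1 where l1: "l1 \<in> L" "F1 = (\<lambda>x. x + l1) ` face p1" using p(2) by (auto simp: FP_rel_def)
  obtain l2 where l2: "l2 \<in> L" "F2 = (\<lambda>x. x + l2) ` face p2" using p(4) by (auto simp: FP_rel_def)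
  \<comment> \<open>The inclusion is translated so that the larger face becomes
    \<open>face p2\<close> itself; only the smaller one is then a translate.\<close>
  define l where "l = l1 - l2"
  have l: "l \<in> L" unfolding l_def by (rule diff_int_flows[OF l1(1) l2(1)])
  have "(\<lambda>x. x + l) ` face p1 \<subseteq> face p2"
  proof
    fix z assume "z \<in> (\<lambda>x. x + l) ` face p1"
    then have "z + l2 \<in> F1" by (auto simp: l1(2) l_def)
    then have "z + l2 \<in> (\<lambda>x. x + l2) ` face p2" using F(3) l2(2) by blast
    then show "z \<in> face p2" by auto
  qed
  note tr = sign_face_translate_subset[OF orient_vec_SV[OF p(1)] orient_vec_SV[OF p(3)] l this]
  \<comment> \<open>The smaller face is the sign face of \<open>p1\<close> with some edges reversed.
    This \<open>q\<close> represents the same class as \<open>p1\<close> and, unlike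
    \<open>p1\<close> in general, is directly comparable with \<open>p2\<close>.\<close>
  obtain q where q: "q \<in> SC E src tgt" "orient_vec (snd q) = orient_vec (snd p1) + 2 *\<^sub>R l"
    using orient_vec_surj[OF tr(1)] by blast
  have "face q = (\<lambda>x. x + l) ` face p1" using tr(2) q(2) by simp
  then have "(face p1, face q) \<in> FP_rel V E src tgt"
    unfolding FP_rel_def using face_in_FP[OF p(1)] face_in_FP[OF q(1)] l
    by (intro CollectI case_prodI conjI bexI)
  then have "face q \<in> C1" using closed[OF C(1)] p(2) F(1) by blast
  moreover have "face p2 \<in> C2" using closed[OF C(2)] p(4) F(2) by blast
  moreover have "SC_le q p2" unfolding SC_le_iff[OF q(1) p(3)] q(2) using tr(3) by blast
  ultimately show "SCbar_le {p \<in> SC E src tgt. face p \<in> C1} {p \<in> SC E src tgt. face p \<in> C2}"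
    using q(1) p(3) unfolding SCbar_le_def by blast
next
  assume "SCbar_le {p \<in> SC E src tgt. face p \<in> C1} {p \<in> SC E src tgt. face p \<in> C2}"
  then obtain p q where pq: "p \<in> SC E src tgt" "face p \<in> C1" "q \<in> SC E src tgt" "face q \<in> C2" "SC_le p q"
    unfolding SCbar_le_def by blast
  have "face p \<subseteq> face q"
    using pq(5) unfolding SC_le_iff[OF pq(1,3)] by (intro sign_face_antimono) blast
  then show "FPbar_le C1 C2" using pq unfolding FPbar_le_def by blast
qed

lemma FPbar_isomorphic_SCbar:
  "\<exists>f. bij_betw f (FPbar V E src tgt) (SCbar E src tgt) \<and>
       (\<forall>C1\<in>FPbar V E src tgt. \<forall>C2\<in>FPbar V E src tgt. FPbar_le C1 C2 \<longleftrightarrow> SCbar_le (f C1) (f C2))"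
proof (intro exI conjI ballI)
  show "bij_betw (\<lambda>C. {p \<in> SC E src tgt. face p \<in> C}) (FPbar V E src tgt) (SCbar E src tgt)"
    unfolding FPbar_def SCbar_def
    by (rule bij_betw_quotient[OF equiv_SC_rel equiv_FP_rel face_in_FP face_rel_iff FP_face_rel_face])
qed (rule FPbar_le_iff)

end

theorem mainTheorem11:
  fixes V :: "'v set" and E :: "'e::finite set" and src tgt :: "'e \<Rightarrow> 'v"
  assumes "finite V"
    and "\<forall>e\<in>E. src e \<in> V \<and> tgt e \<in> V"
    and "graph_connected V E src tgt"
  shows "\<exists>f. bij_betw f (FPbar V E src tgt) (SCbar E src tgt) \<and>
           (\<forall>C1\<in>FPbar V E src tgt. \<forall>C2\<in>FPbar V E src tgt.
              FPbar_le C1 C2 \<longleftrightarrow> SCbar_le (f C1) (f C2))"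
proof -
  interpret finite_graph V E src tgt using assms by unfold_locales auto
  show ?thesis by (rule FPbar_isomorphic_SCbar)
qed

end
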